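(* Let $G$ be an infinite finitely generated group. The following are equivalent. (1) $G$ is virtually $\mathbb{Z}$. (2) For every Cayley graph $\Gamma(G,S)$ of $G$ (i.e. for every finite symmetric generating set $S$ of $G$), the Busemann boundary $\partial_b \Gamma(G,S)$ is finite. (3) For every Cayley graph $\Gamma(G,S)$ of $G$ (i.e. for every finite symmetric generating set $S$ of $G$), the horofunction boundary $\partial \Gamma(G,S)$ is finite. Moreover, when $G$ is virtually $\mathbb{Z}$, for every Cayley graph $\Gamma(G,S)$ of $G$ any horofunction in $\partial\Gamma(G,S)$ is a Busemann point.
   Context: Virtually $\mathbb{Z}$ means containing a finite index infinite cyclic subgroup. Let $S$ be a finite symmetric ($S=S^{-1}$) generating set of $G$. The Cayley graph $\Gamma(G,S)$ has vertex set $G$ and edges $\{x,xs\}$ for $x\in G$, $s\in S$; $d=d_S$ denotes its graph metric (which is left-invariant) and $|x|=|x|_S=d_S(x,1)$, where $1$ is the identity of $G$. Let $L(G,S)$ be the set of functions $h:G\to\mathbb{R}$ with $|h(x)-h(y)|\le d_S(x,y)$ for all $x,y\in G$ and $h(1)=0$, with the topology of pointwise convergence. For $x\in G$ let $b_x\in L(G,S)$ be $b_x(y)=d_S(x,y)-d_S(x,1)$. Let $\overline{\Gamma(G,S)}$ be the closure of $\{b_x : x\in G\}$ in $L(G,S)$. The horofunction boundary is $\partial\Gamma(G,S)=\overline{\Gamma(G,S)}\setminus\{b_x : x\in G\}$, and its elements are called horofunctions. A geodesic in $\Gamma(G,S)$ is an infinite sequence $(\gamma_k)_{k\ge 0}$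 in $G$ with $d_S(\gamma_k,\gamma_m)=k-m$ for all $0\le m\le k$. For every geodesic $\gamma$ the pointwise limit $\gamma_\infty=\lim_{n\to\infty} b_{\gamma_n}$ exists and lies in $\partial\Gamma(G,S)$. A Busemann point is a horofunction of the form $\gamma_\infty$ for some geodesic $\gamma$. The Busemann boundary $\partial_b\Gamma(G,S)$ is the closure in $\overline{\Gamma(G,S)}$ of the set of all Busemann points. *)

theory Defs
  imports "HOL-Analysis.Analysis" "HOL-Algebra.Elementary_Groups"
begin

definition finitely_generated_group :: "('a, 'b) monoid_scheme \<Rightarrow> bool" where
  "finitely_generated_group G \<longleftrightarrow>
     (\<exists>S. finite S \<and> S \<subseteq> carrier G \<and> generate G S = carrier G)"

definition virtually_Z :: "('a, 'b) monoid_scheme \<Rightarrow> bool" where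
  "virtually_Z G \<longleftrightarrow>
     (\<exists>H. subgroup H G \<and> finite (rcosets\<^bsub>G\<^esub> H) \<and>
          infinite H \<and> cyclic_group (G\<lparr>carrier := H\<rparr>))"

definition symmetric_generating_set :: "('a, 'b) monoid_scheme \<Rightarrow> 'a set \<Rightarrow> bool" where
  "symmetric_generating_set G S \<longleftrightarrow>
     finite S \<and> S \<subseteq> carrier G \<and> set_inv\<^bsub>G\<^esub> S = S \<and> generate G S = carrier G"

definition cayley_edges :: "('a, 'b) monoid_scheme \<Rightarrow> 'a set \<Rightarrow> 'a set set" where
  "cayley_edges G S = {{x, x \<otimes>\<^bsub>G\<^esub> s} | x s. x \<in> carrier G \<and> s \<in> S}"

definition cayley_adj :: "('a, 'b) monoid_scheme \<Rightarrow> 'a set \<Rightarrow> ('a \<times> 'a) set" where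
  "cayley_adj G S = {(x, y). {x, y} \<in> cayley_edges G S}"

text \<open>The graph metric: the least length of an edge path. The Cayley graph is connected
  when \<open>S\<close> generates \<open>G\<close>, so the minimum is attained for all group elements. If \<open>\<one> \<in> S\<close>
  the graph has loops, which do not affect the distance.\<close>

definition cayley_dist :: "('a, 'b) monoid_scheme \<Rightarrow> 'a set \<Rightarrow> 'a \<Rightarrow> 'a \<Rightarrow> nat" where
  "cayley_dist G S x y = (LEAST n. (x, y) \<in> cayley_adj G S ^^ n)"

text \<open>Functions on the group are represented by functions on the ambient type that are
  \<^term>\<open>undefined\<close> off the carrier, so that each function on the carrier has exactly one
  representative and the topology of pointwise convergence is the product topology.\<close>

definition lipschitz_functions :: "('a, 'b) monoid_scheme \<Rightarrow> 'a set \<Rightarrow> ('a \<Rightarrow> real) set" where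
  "lipschitz_functions G S =
     {h \<in> extensional (carrier G).
        (\<forall>x \<in> carrier G. \<forall>y \<in> carrier G. \<bar>h x - h y\<bar> \<le> real (cayley_dist G S x y)) \<and>
        h \<one>\<^bsub>G\<^esub> = 0}"

definition lipschitz_topology ::
    "('a, 'b) monoid_scheme \<Rightarrow> 'a set \<Rightarrow> ('a \<Rightarrow> real) topology" where
  "lipschitz_topology G S =
     subtopology (powertop_real (carrier G)) (lipschitz_functions G S)"

definition busemann_function ::
    "('a, 'b) monoid_scheme \<Rightarrow> 'a set \<Rightarrow> 'a \<Rightarrow> 'a \<Rightarrow> real" where
  "busemann_function G S x =
     (\<lambda>y \<in> carrier G. real (cayley_dist G S x y) - real (cayley_dist G S x \<one>\<^bsub>G\<^esub>))"

definition horofunction_compactification ::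
    "('a, 'b) monoid_scheme \<Rightarrow> 'a set \<Rightarrow> ('a \<Rightarrow> real) set" where
  "horofunction_compactification G S =
     lipschitz_topology G S closure_of (busemann_function G S ` carrier G)"

definition horofunction_boundary ::
    "('a, 'b) monoid_scheme \<Rightarrow> 'a set \<Rightarrow> ('a \<Rightarrow> real) set" where
  "horofunction_boundary G S =
     horofunction_compactification G S - busemann_function G S ` carrier G"

definition cayley_geodesic ::
    "('a, 'b) monoid_scheme \<Rightarrow> 'a set \<Rightarrow> (nat \<Rightarrow> 'a) \<Rightarrow> bool" where
  "cayley_geodesic G S \<gamma> \<longleftrightarrow>
     range \<gamma> \<subseteq> carrier G \<and> (\<forall>k m. m \<le> k \<longrightarrow> cayley_dist G S (\<gamma> k) (\<gamma> m) = k - m)"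

definition busemann_points ::
    "('a, 'b) monoid_scheme \<Rightarrow> 'a set \<Rightarrow> ('a \<Rightarrow> real) set" where
  "busemann_points G S =
     {h \<in> horofunction_boundary G S.
        \<exists>\<gamma>. cayley_geodesic G S \<gamma> \<and>
          limitin (lipschitz_topology G S) (\<lambda>n. busemann_function G S (\<gamma> n)) h sequentially}"

definition busemann_boundary ::
    "('a, 'b) monoid_scheme \<Rightarrow> 'a set \<Rightarrow> ('a \<Rightarrow> real) set" where
  "busemann_boundary G S =
     subtopology (lipschitz_topology G S) (horofunction_compactification G S)
       closure_of busemann_points G S"

end

theory Submission
  imports Defs
begin

text \<open>
  Suppose first that \<open>G\<close> is virtually \<open>\<int>\<close>. Some infinite order element \<open>c\<close> generates a subgroup of
  finite index and is conjugated by every element of \<open>G\<close> to \<open>c\<close> or its inverse. The powers of \<open>c\<close>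
  move along the Cayley graph at a stable speed, and because long geodesics revisit cosets of the
  subgroup this speed is attained: a suitable power \<open>u\<close> is straight, that is,
  \<open>\<bar>u\<^sup>n\<bar> = n \<bar>u\<bar>\<close> (\<open>straight_axis_exists\<close>). Every conjugate of \<open>u\<close> is \<open>u\<close> or its inverse, so it is
  straight as well, and hence the points \<open>u\<^sup>n x\<close>, for \<open>n \<ge> 0\<close> or for \<open>n \<le> 0\<close>, lie on a geodesic
  starting at \<open>x\<close>. Thus finitely many geodesics cover \<open>G\<close>
  (\<open>covered_by_geodesics_if_virtually_Z\<close>). Busemann functions converge along geodesics, so the
  horofunction boundary consists of the finitely many limits, all of them Busemann points
  (\<open>boundary_if_covered_by_geodesics\<close>).

  Conversely, suppose that every Cayley graph has only finitely many Busemann points. Fix one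
  generating set \<open>S\<^sub>0\<close>. The group permutes its Busemann points by translation, so they are all fixed
  by a finite index subgroup \<open>H\<close>, and a function fixed by \<open>H\<close> restricts to a homomorphism on \<open>H\<close>.
  Choose \<open>t\<close> in \<open>H\<close> and a Busemann point \<open>h\<close> such that \<open>h(t) = -p < 0\<close> and no other Busemann point
  is larger than \<open>p\<close> in absolute value at \<open>t\<close>. The new generating set
  \<open>S = S\<^sub>0 \<union> {t\<^sup>2, t\<^sup>-\<^sup>2}\<close> is designed so that \<open>h / (2 p)\<close> is still Lipschitz, while the only
  edges along which it changes by one are those labelled \<open>t\<^sup>2\<close> or \<open>t\<^sup>-\<^sup>2\<close>; in particular the
  powers of \<open>t\<^sup>2\<close> form a geodesic for \<open>S\<close>. Let \<open>k\<close> be its Busemann point. Then \<open>h / (2 p) \<le> k\<close>. On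
  a finite index subgroup \<open>L\<close> both functions are homomorphisms, so there they agree. If \<open>y\<close> in \<open>L\<close>
  satisfies \<open>h(y) = 0\<close>, then \<open>k(y) = 0\<close>, so for some \<open>n\<close> the distance from \<open>t\<^sup>2\<^sup>n\<close> to \<open>y\<close> is \<open>n\<close> and
  all edges of a geodesic between them must be labelled by \<open>t\<^sup>2\<close> or its inverse. Therefore \<open>y\<close> is a
  power of \<open>t\<close> with \<open>h(y) = 0\<close>, that is, \<open>y = 1\<close>. So \<open>h\<close> embeds \<open>L\<close> into \<open>\<int>\<close>
  (\<open>virtually_Z_if_finite_busemann_points\<close>).
\<close>

section \<open>The word metric\<close>

locale cayley_graph = group G for G :: "('a, 'b) monoid_scheme" (structure) +
  fixes S :: "'a set"
  assumes gens: "symmetric_generating_set G S"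
begin

abbreviation d :: "'a \<Rightarrow> 'a \<Rightarrow> nat" where "d \<equiv> cayley_dist G S"

lemma finite_S: "finite S"
  and S_carrier: "s \<in> S \<Longrightarrow> s \<in> carrier G"
  and S_inv: "s \<in> S \<Longrightarrow> inv s \<in> S"
  and generate_S: "generate G S = carrier G"
  using gens by (auto simp: symmetric_generating_set_def SET_INV_def)

lemma adj_iff: "(x, y) \<in> cayley_adj G S \<longleftrightarrow> x \<in> carrier G \<and> (\<exists>s\<in>S. y = x \<otimes> s)"
proof
  assume "(x, y) \<in> cayley_adj G S"
  then obtain z s where z: "z \<in> carrier G" "s \<in> S" "{x, y} = {z, z \<otimes> s}"
    by (auto simp: cayley_adj_def cayley_edges_def)
  then consider "x = z" "y = z \<otimes> s" | "x = z \<otimes> s" "y = z"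
    by (auto simp: doubleton_eq_iff)
  then show "x \<in> carrier G \<and> (\<exists>s\<in>S. y = x \<otimes> s)"
  proof cases
    case 1
    then show ?thesis using z by blast
  next
    case 2
    then have "y = x \<otimes> inv s"
      using z S_carrier by (simp add: m_assoc)
    moreover have "x \<in> carrier G" using 2 z S_carrier by simp
    ultimately show ?thesis using S_inv z(2) by blast
  qed
next
  assume "x \<in> carrier G \<and> (\<exists>s\<in>S. y = x \<otimes> s)"
  then show "(x, y) \<in> cayley_adj G S"
    by (auto simp: cayley_adj_def cayley_edges_def)
qed

lemma adj_sym: "(x, y) \<in> cayley_adj G S \<Longrightarrow> (y, x) \<in> cayley_adj G S"
  by (simp add: cayley_adj_def insert_commute)

lemma adj_translate:
  "g \<in> carrier G \<Longrightarrow> (x, y) \<in> cayley_adj G S \<Longrightarrow> (g \<otimes> x, g \<otimes> y) \<in> cayley_adj G S"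
  using S_carrier m_assoc by (fastforce simp: adj_iff)

lemma path_translate:
  "g \<in> carrier G \<Longrightarrow> (x, y) \<in> cayley_adj G S ^^ n
    \<Longrightarrow> (g \<otimes> x, g \<otimes> y) \<in> cayley_adj G S ^^ n"
proof (induction n arbitrary: y)
  case (Suc n)
  then show ?case using adj_translate by (meson relpow_Suc_E relpow_Suc_I)
qed simp

lemma path_sym: "(x, y) \<in> cayley_adj G S ^^ n \<Longrightarrow> (y, x) \<in> cayley_adj G S ^^ n"
proof (induction n arbitrary: y)
  case (Suc n)
  then show ?case using adj_sym by (meson relpow_Suc_E relpow_Suc_I2)
qed simp

lemma path_from_one: "x \<in> generate G S \<Longrightarrow> \<exists>n. (\<one>, x) \<in> cayley_adj G S ^^ n"
proof (induction rule: generate.induct)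
  case one
  have "(\<one>, \<one>) \<in> cayley_adj G S ^^ 0" by simp
  then show ?case by blast
next
  case (incl h)
  then have "(\<one>, h) \<in> cayley_adj G S ^^ 1" using S_carrier by (simp add: adj_iff)
  then show ?case by blast
next
  case (inv h)
  then have "(\<one>, inv h) \<in> cayley_adj G S ^^ 1" using S_carrier S_inv by (simp add: adj_iff)
  then show ?case by blast
next
  case (eng h1 h2)
  then obtain m n where mn: "(\<one>, h1) \<in> cayley_adj G S ^^ m" "(\<one>, h2) \<in> cayley_adj G S ^^ n"
    by blast
  have "h1 \<in> carrier G" using eng generate_S by simp
  then have "(h1, h1 \<otimes> h2) \<in> cayley_adj G S ^^ n"
    using path_translate[OF _ mn(2)] by force
  with mn(1) have "(\<one>, h1 \<otimes> h2) \<in> cayley_adj G S ^^ (m + n)"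
    unfolding relpow_add by blast
  then show ?case by blast
qed

lemma path_dist:
  assumes "x \<in> carrier G" "y \<in> carrier G"
  shows "(x, y) \<in> cayley_adj G S ^^ d x y"
proof -
  obtain n where "(\<one>, inv x \<otimes> y) \<in> cayley_adj G S ^^ n"
    using path_from_one generate_S assms by (metis inv_closed m_closed)
  from path_translate[OF assms(1) this] have "(x, y) \<in> cayley_adj G S ^^ n"
    using assms by (simp add: m_assoc[symmetric])
  then show ?thesis unfolding cayley_dist_def by (rule LeastI)
qed

lemma dist_le: "(x, y) \<in> cayley_adj G S ^^ n \<Longrightarrow> d x y \<le> n"
  unfolding cayley_dist_def by (rule Least_le)

lemma dist_self [simp]: "d x x = 0"
  using dist_le[of x x 0] by simp

lemma dist_eq_0D: "x \<in> carrier G \<Longrightarrow> y \<in> carrier G \<Longrightarrow> d x y = 0 \<Longrightarrow> x = y"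
  using path_dist[of x y] by simp

lemma dist_sym: "d x y = d y x"
  unfolding cayley_dist_def using path_sym by metis

lemma dist_triangle:
  assumes "x \<in> carrier G" "y \<in> carrier G" "z \<in> carrier G"
  shows "d x z \<le> d x y + d y z"
proof (rule dist_le)
  show "(x, z) \<in> cayley_adj G S ^^ (d x y + d y z)"
    unfolding relpow_add using assms by (intro relcompI[of _ y] path_dist)
qed

lemma dist_translate [simp]:
  assumes "g \<in> carrier G" "x \<in> carrier G" "y \<in> carrier G"
  shows "d (g \<otimes> x) (g \<otimes> y) = d x y"
proof (rule antisym)
  show "d (g \<otimes> x) (g \<otimes> y) \<le> d x y"
    by (intro dist_le path_translate path_dist assms)
  have "d (inv g \<otimes> (g \<otimes> x)) (inv g \<otimes> (g \<otimes> y)) \<le> d (g \<otimes> x) (g \<otimes> y)"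
    by (intro dist_le path_translate path_dist) (use assms in auto)
  then show "d x y \<le> d (g \<otimes> x) (g \<otimes> y)"
    using assms by (simp add: m_assoc[symmetric])
qed

lemma dist_one_diff:
  assumes "x \<in> carrier G" "y \<in> carrier G"
  shows "d x y = d \<one> (inv x \<otimes> y)"
  using dist_translate[of "inv x" x y] assms by simp

lemma dist_generator: "x \<in> carrier G \<Longrightarrow> s \<in> S \<Longrightarrow> d x (x \<otimes> s) \<le> 1"
  by (rule dist_le) (auto simp: adj_iff)

lemma dist_SucE:
  assumes "x \<in> carrier G" "y \<in> carrier G" "d x y = Suc n"
  obtains s where "s \<in> S" "d (x \<otimes> s) y = n"
proof -
  obtain z where z: "(x, z) \<in> cayley_adj G S" "(z, y) \<in> cayley_adj G S ^^ n"
    using path_dist[OF assms(1,2)] assms(3) by (metis relpow_Suc_D2)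
  then obtain s where s: "s \<in> S" "z = x \<otimes> s" by (auto simp: adj_iff)
  have "d z y \<le> n" using z by (simp add: dist_le)
  moreover have "Suc n \<le> d x z + d z y"
    using dist_triangle[of x z y] assms s S_carrier by simp
  moreover have "d x z \<le> 1" using dist_generator assms s by simp
  ultimately have "d z y = n" by linarith
  then show thesis using that s by simp
qed

lemma finite_ball: "x \<in> carrier G \<Longrightarrow> finite {y \<in> carrier G. d x y \<le> n}"
proof (induction n arbitrary: x)
  case 0
  then have "{y \<in> carrier G. d x y \<le> 0} \<subseteq> {x}" using dist_eq_0D by auto
  then show ?case using finite_subset by blast
next
  case (Suc n)
  have "{y \<in> carrier G. d x y \<le> Suc n}
      \<subseteq> {y \<in> carrier G. d x y \<le> n} \<union> (\<Union>s\<in>S. {y \<in> carrier G. d (x \<otimes> s) y \<le> n})"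
  proof
    fix y assume y: "y \<in> {y \<in> carrier G. d x y \<le> Suc n}"
    show "y \<in> {y \<in> carrier G. d x y \<le> n} \<union> (\<Union>s\<in>S. {y \<in> carrier G. d (x \<otimes> s) y \<le> n})"
    proof (cases "d x y = Suc n")
      case True
      then obtain s where "s \<in> S" "d (x \<otimes> s) y = n" using dist_SucE y Suc.prems by blast
      then show ?thesis using y by auto
    qed (use y in auto)
  qed
  moreover have "finite ({y \<in> carrier G. d x y \<le> n}
      \<union> (\<Union>s\<in>S. {y \<in> carrier G. d (x \<otimes> s) y \<le> n}))"
    using Suc finite_S S_carrier by simp
  ultimately show ?case using finite_subset by blast
qed

text \<open>The estimate is one-sided because in its extremal case the direction of the steps matters.\<close>

lemma increase_le_if_edges:
  fixes f :: "'a \<Rightarrow> real"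
  assumes edge: "\<And>x s. x \<in> carrier G \<Longrightarrow> s \<in> S \<Longrightarrow> f (x \<otimes> s) - f x \<le> C"
    and "x \<in> carrier G" and y: "y \<in> carrier G"
  shows "f y - f x \<le> C * real (d x y)"
  using assms(2)
proof (induction "d x y" arbitrary: x)
  case 0
  then show ?case using dist_eq_0D y by auto
next
  case (Suc n)
  have x: "x \<in> carrier G" by fact
  obtain s where s: "s \<in> S" "d (x \<otimes> s) y = n"
    using dist_SucE[OF x y Suc(2)[symmetric]] .
  then have "f y - f (x \<otimes> s) \<le> C * real n" using Suc(1)[of "x \<otimes> s"] x S_carrier by simp
  moreover have "C * real (d x y) = C * real n + C"
    by (simp add: Suc(2)[symmetric] algebra_simps)
  ultimately show ?case using edge[OF x s(1)] by linarith
qed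

end

section \<open>Geodesic rays and their Busemann points\<close>

text \<open>This makes all limits of Busemann functions along geodesics exact at each point: the values
  are differences of two decreasing integer sequences that are bounded below.\<close>

lemma antimono_int_eventually_const:
  fixes g :: "nat \<Rightarrow> int"
  assumes dec: "\<And>m n. m \<le> n \<Longrightarrow> g n \<le> g m" and low: "\<And>n. B \<le> g n"
  shows "\<exists>v. \<forall>\<^sub>F n in sequentially. g n = v"
proof -
  obtain N where N: "\<And>n. nat (g N - B) \<le> nat (g n - B)"
    using ex_has_least_nat[of "\<lambda>_. True" 0 "\<lambda>n. nat (g n - B)"] by blast
  have "g n = g N" if "N \<le> n" for n
    using N[of n] dec[OF that] low[of n] low[of N] by linarith
  then show ?thesis unfolding eventually_sequentially by blast
qed

context cayley_graph
begin

abbreviation b :: "'a \<Rightarrow> 'a \<Rightarrow> real" where "b \<equiv> busemann_function G S"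

lemma b_eq: "y \<in> carrier G \<Longrightarrow> b x y = real (d x y) - real (d x \<one>)"
  by (simp add: busemann_function_def)

lemma b_extensional: "b x \<in> extensional (carrier G)"
  by (simp add: busemann_function_def)

lemma b_lipschitz: "x \<in> carrier G \<Longrightarrow> b x \<in> lipschitz_functions G S"
proof -
  assume x: "x \<in> carrier G"
  have "\<bar>b x y - b x z\<bar> \<le> real (d y z)" if "y \<in> carrier G" "z \<in> carrier G" for y z
    using dist_triangle[of x y z] dist_triangle[of x z y] dist_sym[of y z] x that
    by (simp add: b_eq)
  then show ?thesis
    using b_extensional by (auto simp: lipschitz_functions_def b_eq)
qed

lemma Hausdorff_lipschitz_topology: "Hausdorff_space (lipschitz_topology G S)"
  unfolding lipschitz_topology_def
  by (intro Hausdorff_space_subtopology) (simp add: Hausdorff_space_product_topology)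

lemma topspace_lipschitz: "topspace (lipschitz_topology G S) = lipschitz_functions G S"
  by (auto simp: lipschitz_topology_def lipschitz_functions_def PiE_UNIV_domain extensional_def
      topspace_product_topology PiE_def)

text \<open>Busemann functions take integer values, so for them pointwise convergence means that each
  value is eventually constant. In this form limits of values can be computed without any
  estimates.\<close>

definition converges_to :: "(nat \<Rightarrow> 'a) \<Rightarrow> ('a \<Rightarrow> real) \<Rightarrow> bool" where
  "converges_to \<gamma> f \<longleftrightarrow> range \<gamma> \<subseteq> carrier G \<and> f \<in> extensional (carrier G) \<and>
     (\<forall>y\<in>carrier G. \<forall>\<^sub>F n in sequentially. b (\<gamma> n) y = f y)"

lemma converges_toD:
  "converges_to \<gamma> f \<Longrightarrow> y \<in> carrier G \<Longrightarrow> \<forall>\<^sub>F n in sequentially. b (\<gamma> n) y = f y"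
  by (simp add: converges_to_def)

lemma converges_to_carrier: "converges_to \<gamma> f \<Longrightarrow> \<gamma> n \<in> carrier G"
  by (auto simp: converges_to_def)

lemma converges_to_lipschitz:
  assumes "converges_to \<gamma> f"
  shows "f \<in> lipschitz_functions G S"
proof -
  have "\<bar>f x - f y\<bar> \<le> real (d x y)" if "x \<in> carrier G" "y \<in> carrier G" for x y
  proof -
    have "\<forall>\<^sub>F n in sequentially. b (\<gamma> n) x = f x \<and> b (\<gamma> n) y = f y"
      using converges_toD[OF assms] that by (simp add: eventually_conj)
    then obtain n where "b (\<gamma> n) x = f x \<and> b (\<gamma> n) y = f y"
      using eventually_happens'[OF sequentially_bot] by blast
    moreover have "b (\<gamma> n) \<in> lipschitz_functions G S"
      using assms b_lipschitz by (auto simp: converges_to_def)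
    then have "\<bar>b (\<gamma> n) x - b (\<gamma> n) y\<bar> \<le> real (d x y)"
      using that by (simp add: lipschitz_functions_def)
    ultimately show ?thesis by simp
  qed
  moreover have "f \<one> = 0"
    using converges_toD[OF assms one_closed] by (simp add: b_eq eventually_const_iff)
  ultimately show ?thesis using assms by (simp add: lipschitz_functions_def converges_to_def)
qed

lemma converges_to_Ints:
  assumes "converges_to \<gamma> f" "y \<in> carrier G"
  shows "f y \<in> \<int>"
proof -
  obtain n where "b (\<gamma> n) y = f y"
    using eventually_happens'[OF sequentially_bot converges_toD[OF assms]] by blast
  then show ?thesis using b_eq assms by (metis Ints_diff Ints_of_nat)
qed

lemma converges_to_limitin:
  assumes "converges_to \<gamma> f"
  shows "limitin (lipschitz_topology G S) (\<lambda>n. b (\<gamma> n)) f sequentially"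
proof -
  have "b (\<gamma> n) \<in> lipschitz_functions G S" for n
    using assms b_lipschitz by (auto simp: converges_to_def)
  moreover have "((\<lambda>n. b (\<gamma> n) y) \<longlongrightarrow> f y) sequentially" if "y \<in> carrier G" for y
    using converges_toD[OF assms that] by (rule tendsto_eventually)
  ultimately show ?thesis
    using converges_to_lipschitz[OF assms] b_extensional
    unfolding lipschitz_topology_def limitin_subtopology limitin_componentwise
    by (auto simp: lipschitz_functions_def PiE_def)
qed

lemma converges_to_compactification:
  assumes "converges_to \<gamma> f"
  shows "f \<in> horofunction_compactification G S"
  unfolding horofunction_compactification_def in_closure_of
proof (intro conjI allI impI)
  show "f \<in> topspace (lipschitz_topology G S)"
    using converges_to_lipschitz[OF assms] topspace_lipschitz by simp
next
  fix U assume "f \<in> U \<and> openin (lipschitz_topology G S) U"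
  then have "\<forall>\<^sub>F n in sequentially. b (\<gamma> n) \<in> U"
    using converges_to_limitin[OF assms] by (simp add: limitin_def)
  then obtain n where "b (\<gamma> n) \<in> U"
    using eventually_happens'[OF sequentially_bot] by blast
  then show "\<exists>y. y \<in> b ` carrier G \<and> y \<in> U"
    using assms by (auto simp: converges_to_def)
qed

lemma geodesic_carrier: "cayley_geodesic G S \<gamma> \<Longrightarrow> \<gamma> n \<in> carrier G"
  by (auto simp: cayley_geodesic_def)

lemma geodesic_dist: "cayley_geodesic G S \<gamma> \<Longrightarrow> m \<le> n \<Longrightarrow> d (\<gamma> n) (\<gamma> m) = n - m"
  by (simp add: cayley_geodesic_def)

text \<open>A path of unit steps that at arbitrarily late times is as far from its start as it can be
  has not lost any distance in between.\<close>

lemma geodesicI: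
  assumes closed: "\<And>n. \<gamma> n \<in> carrier G"
    and edge: "\<And>n. d (\<gamma> n) (\<gamma> (Suc n)) \<le> 1"
    and far: "\<And>n. \<exists>N\<ge>n. N \<le> d (\<gamma> 0) (\<gamma> N)"
  shows "cayley_geodesic G S \<gamma>"
proof -
  have le: "d (\<gamma> m) (\<gamma> (m + k)) \<le> k" for m k
  proof (induction k)
    case (Suc k)
    then show ?case
      using dist_triangle[of "\<gamma> m" "\<gamma> (m + k)" "\<gamma> (m + Suc k)"] closed edge[of "m + k"] by simp
  qed simp
  have "d (\<gamma> k) (\<gamma> m) = k - m" if "m \<le> k" for k m
  proof -
    obtain N where N: "k \<le> N" "N \<le> d (\<gamma> 0) (\<gamma> N)" using far by blast
    have "d (\<gamma> 0) (\<gamma> N) \<le> d (\<gamma> 0) (\<gamma> m) + d (\<gamma> m) (\<gamma> k) + d (\<gamma> k) (\<gamma> N)"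
      using dist_triangle[of "\<gamma> 0" "\<gamma> m" "\<gamma> N"] dist_triangle[of "\<gamma> m" "\<gamma> k" "\<gamma> N"] closed
      by simp
    then show ?thesis
      using le[of 0 m] le[of m "k - m"] le[of k "N - k"] N that dist_sym[of "\<gamma> k" "\<gamma> m"] by simp
  qed
  then show ?thesis using closed by (auto simp: cayley_geodesic_def)
qed

text \<open>Konig's lemma: if infinitely many elements are reached from \<^term>\<open>\<one>\<close> through \<^term>\<open>x\<close> along
  geodesics, then the same holds for one of the finitely many successors of \<^term>\<open>x\<close>.\<close>

lemma geodesic_ray_exists:
  assumes inf: "infinite (carrier G)"
  obtains \<gamma> where "cayley_geodesic G S \<gamma>" "\<gamma> 0 = \<one>"
proof -
  define Z where "Z x = {z \<in> carrier G. d \<one> z = d \<one> x + d x z}" for x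
  have step: "\<exists>s\<in>S. infinite (Z (x \<otimes> s)) \<and> d \<one> (x \<otimes> s) = Suc (d \<one> x)"
    if x: "x \<in> carrier G" and infx: "infinite (Z x)" for x
  proof -
    let ?T = "{s \<in> S. d \<one> (x \<otimes> s) = Suc (d \<one> x)}"
    have "Z x - {x} \<subseteq> (\<Union>s\<in>?T. Z (x \<otimes> s))"
    proof
      fix z assume "z \<in> Z x - {x}"
      then have z: "z \<in> carrier G" "d \<one> z = d \<one> x + d x z" "z \<noteq> x" by (auto simp: Z_def)
      then obtain n where n: "d x z = Suc n" using dist_eq_0D[OF x z(1)] by (cases "d x z") auto
      obtain s where s: "s \<in> S" "d (x \<otimes> s) z = n" using dist_SucE[OF x z(1) n] .
      have xs: "x \<otimes> s \<in> carrier G" using x s S_carrier by simp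
      have "d \<one> z \<le> d \<one> (x \<otimes> s) + n" using dist_triangle[OF one_closed xs z(1)] s by simp
      moreover have "d \<one> (x \<otimes> s) \<le> d \<one> x + 1"
        using dist_triangle[OF one_closed x xs] dist_generator[OF x s(1)] by simp
      ultimately have "s \<in> ?T" "z \<in> Z (x \<otimes> s)" using s z n by (auto simp: Z_def)
      then show "z \<in> (\<Union>s\<in>?T. Z (x \<otimes> s))" by blast
    qed
    moreover have "infinite (Z x - {x})" using infx by simp
    ultimately have "infinite (\<Union>s\<in>?T. Z (x \<otimes> s))" using finite_subset by blast
    then show ?thesis using finite_S by auto
  qed
  have "\<exists>\<gamma>. \<gamma> 0 = \<one> \<and> (\<forall>n. (\<gamma> n \<in> carrier G \<and> infinite (Z (\<gamma> n))) \<and>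
      (\<exists>s\<in>S. \<gamma> (Suc n) = \<gamma> n \<otimes> s) \<and> d \<one> (\<gamma> (Suc n)) = Suc (d \<one> (\<gamma> n)))"
  proof -
    define next_vertex where "next_vertex x = x \<otimes>
        (SOME s. s \<in> S \<and> infinite (Z (x \<otimes> s)) \<and> d \<one> (x \<otimes> s) = Suc (d \<one> x))" for x
    have next_vertex: "(\<exists>s\<in>S. next_vertex x = x \<otimes> s) \<and> infinite (Z (next_vertex x)) \<and>
        d \<one> (next_vertex x) = Suc (d \<one> x)" if "x \<in> carrier G" "infinite (Z x)" for x
      using someI_ex[OF step[OF that, unfolded Bex_def]] unfolding next_vertex_def by blast
    define \<gamma> where "\<gamma> n = (next_vertex ^^ n) \<one>" for n
    have "\<gamma> n \<in> carrier G \<and> infinite (Z (\<gamma> n))" for n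
    proof (induction n)
      case 0
      then show ?case using inf by (simp add: \<gamma>_def Z_def)
    next
      case (Suc n)
      moreover have "\<gamma> (Suc n) = next_vertex (\<gamma> n)" by (simp add: \<gamma>_def)
      ultimately show ?case using next_vertex[of "\<gamma> n"] S_carrier by auto
    qed
    moreover have "\<gamma> (Suc n) = next_vertex (\<gamma> n)" "\<gamma> 0 = \<one>" for n by (simp_all add: \<gamma>_def)
    ultimately show ?thesis using next_vertex by (intro exI[of _ \<gamma>]) auto
  qed
  then obtain \<gamma> where \<gamma>: "\<gamma> 0 = \<one>" "\<And>n. \<gamma> n \<in> carrier G"
      "\<And>n. \<exists>s\<in>S. \<gamma> (Suc n) = \<gamma> n \<otimes> s" "\<And>n. d \<one> (\<gamma> (Suc n)) = Suc (d \<one> (\<gamma> n))"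
    by auto
  have "d \<one> (\<gamma> n) = n" for n
    by (induction n) (use \<gamma> in auto)
  then have "cayley_geodesic G S \<gamma>"
    using \<gamma>(1,2)
  proof (intro geodesicI)
    show "d (\<gamma> n) (\<gamma> (Suc n)) \<le> 1" for n
      using \<gamma>(3)[of n] dist_generator[OF \<gamma>(2)] by auto
  qed auto
  then show thesis using that \<gamma> by blast
qed

text \<open>Along a geodesic the quantity \<^term>\<open>int (d (\<gamma> n) y) - int n\<close> decreases by the triangle
  inequality and is bounded below. The limit decreases at unit speed along the geodesic, so it is
  unbounded below, whereas \<^term>\<open>b x\<close> has its minimum at \<^term>\<open>x\<close>; hence it is a boundary point.\<close>

lemma geodesic_converges:
  assumes geo: "cayley_geodesic G S \<gamma>"
  obtains f where "converges_to \<gamma> f" "f \<in> busemann_points G S"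
proof -
  have \<gamma>: "\<gamma> n \<in> carrier G" for n using geodesic_carrier[OF geo] .
  have "\<exists>v. \<forall>\<^sub>F n in sequentially. int (d (\<gamma> n) y) - int n = v" if y: "y \<in> carrier G" for y
  proof (rule antimono_int_eventually_const)
    show "int (d (\<gamma> n) y) - int n \<le> int (d (\<gamma> m) y) - int m" if "m \<le> n" for m n
      using dist_triangle[of "\<gamma> n" "\<gamma> m" y] geodesic_dist[OF geo that] \<gamma> y that by simp
    show "- int (d (\<gamma> 0) y) \<le> int (d (\<gamma> n) y) - int n" for n
      using dist_triangle[of "\<gamma> n" y "\<gamma> 0"] geodesic_dist[OF geo, of 0 n] dist_sym[of y "\<gamma> 0"] \<gamma> y
      by simp
  qed
  then obtain v where v: "\<And>y. y \<in> carrier G \<Longrightarrow>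
      \<forall>\<^sub>F n in sequentially. int (d (\<gamma> n) y) - int n = v y"
    by metis
  define f where "f = (\<lambda>y\<in>carrier G. real_of_int (v y - v \<one>))"
  have conv: "converges_to \<gamma> f"
    unfolding converges_to_def
  proof (intro conjI ballI)
    fix y assume y: "y \<in> carrier G"
    show "\<forall>\<^sub>F n in sequentially. b (\<gamma> n) y = f y"
      using v[OF y] v[OF one_closed]
    proof eventually_elim
      case (elim n)
      have "b (\<gamma> n) y = real_of_int (int (d (\<gamma> n) y) - int (d (\<gamma> n) \<one>))"
        using y by (simp add: b_eq)
      then show ?case using y elim by (simp add: f_def)
    qed
  qed (use \<gamma> in \<open>auto simp: f_def\<close>)
  have "f \<noteq> b x" if x: "x \<in> carrier G" for x
  proof
    assume fx: "f = b x"
    define m where "m = d (\<gamma> 0) \<one> + d x \<one> + 1"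
    have "\<forall>\<^sub>F n in sequentially. b (\<gamma> n) (\<gamma> m) = f (\<gamma> m) \<and> m \<le> n"
      using converges_toD[OF conv \<gamma>] eventually_ge_at_top by (rule eventually_conj)
    then obtain n where n: "b (\<gamma> n) (\<gamma> m) = f (\<gamma> m)" "m \<le> n"
      using eventually_happens'[OF sequentially_bot] by blast
    have "d (\<gamma> n) (\<gamma> 0) \<le> d (\<gamma> n) \<one> + d \<one> (\<gamma> 0)"
      using dist_triangle \<gamma> by blast
    then have "n \<le> d (\<gamma> n) \<one> + d (\<gamma> 0) \<one>"
      using geodesic_dist[OF geo, of 0 n] dist_sym by simp
    then have "b (\<gamma> n) (\<gamma> m) \<le> real (d (\<gamma> 0) \<one>) - real m"
      using geodesic_dist[OF geo n(2)] n(2) \<gamma> by (simp add: b_eq)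
    moreover have "b x (\<gamma> m) \<ge> - real (d x \<one>)" using \<gamma> by (simp add: b_eq)
    ultimately show False using n fx by (simp add: m_def)
  qed
  then have "f \<in> horofunction_boundary G S"
    using converges_to_compactification[OF conv] by (auto simp: horofunction_boundary_def)
  then have "f \<in> busemann_points G S"
    using geo converges_to_limitin[OF conv] by (auto simp: busemann_points_def)
  with conv show thesis by (rule that)
qed

lemma converges_to_unique: "converges_to \<gamma> f \<Longrightarrow> converges_to \<gamma> g \<Longrightarrow> f = g"
  using limitin_Hausdorff_unique[OF _ _ sequentially_bot Hausdorff_lipschitz_topology]
    converges_to_limitin by blast

lemma busemann_pointE:
  assumes "f \<in> busemann_points G S"
  obtains \<gamma> where "cayley_geodesic G S \<gamma>" "converges_to \<gamma> f"
proof -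
  obtain \<gamma> where geo: "cayley_geodesic G S \<gamma>"
      and lim: "limitin (lipschitz_topology G S) (\<lambda>n. b (\<gamma> n)) f sequentially"
    using assms by (auto simp: busemann_points_def)
  obtain g where g: "converges_to \<gamma> g" using geodesic_converges[OF geo] .
  have "f = g"
    using limitin_Hausdorff_unique[OF lim converges_to_limitin[OF g] sequentially_bot
        Hausdorff_lipschitz_topology] .
  with geo g show thesis using that by simp
qed

lemma busemann_point_lipschitz:
  "f \<in> busemann_points G S \<Longrightarrow> f \<in> lipschitz_functions G S"
  using busemann_pointE converges_to_lipschitz by blast

lemma busemann_point_Ints: "f \<in> busemann_points G S \<Longrightarrow> y \<in> carrier G \<Longrightarrow> f y \<in> \<int>"
  using busemann_pointE converges_to_Ints by metis

lemma converges_to_along_geodesic: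
  assumes geo: "cayley_geodesic G S \<gamma>" and conv: "converges_to \<gamma> f"
  shows "f (\<gamma> m) = f (\<gamma> 0) - real m"
proof -
  have "\<forall>\<^sub>F n in sequentially. (b (\<gamma> n) (\<gamma> m) = f (\<gamma> m) \<and> b (\<gamma> n) (\<gamma> 0) = f (\<gamma> 0)) \<and> m \<le> n"
    using converges_toD[OF conv geodesic_carrier[OF geo]] eventually_ge_at_top
    by (intro eventually_conj)
  then obtain n where "b (\<gamma> n) (\<gamma> m) = f (\<gamma> m)" "b (\<gamma> n) (\<gamma> 0) = f (\<gamma> 0)" "m \<le> n"
    using eventually_happens'[OF sequentially_bot] by blast
  then show ?thesis
    using geodesic_dist[OF geo, of m n] geodesic_dist[OF geo, of 0 n] geodesic_carrier[OF geo]
    by (simp add: b_eq)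
qed

lemma busemann_points_subset: "busemann_points G S \<subseteq> horofunction_boundary G S"
  by (auto simp: busemann_points_def)

text \<open>Finite sets are closed, so passing to the closure changes nothing as far as finiteness is
  concerned.\<close>

lemma finite_busemann_boundary_iff:
  "finite (busemann_boundary G S) \<longleftrightarrow> finite (busemann_points G S)"
proof -
  define X where "X = subtopology (lipschitz_topology G S) (horofunction_compactification G S)"
  have top: "busemann_points G S \<subseteq> topspace X"
    using busemann_points_subset busemann_point_lipschitz topspace_lipschitz
    by (auto simp: X_def horofunction_boundary_def)
  show ?thesis
  proof
    assume "finite (busemann_boundary G S)"
    then show "finite (busemann_points G S)"
      using closure_of_subset[OF top] finite_subset
      unfolding busemann_boundary_def X_def by blast
  next
    assume fin: "finite (busemann_points G S)"
    have "t1_space X"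
      unfolding X_def
      by (intro Hausdorff_imp_t1_space Hausdorff_space_subtopology Hausdorff_lipschitz_topology)
    then have "closedin X (busemann_points G S)"
      using fin top by (simp add: t1_space_closedin_finite)
    then show "finite (busemann_boundary G S)"
      using fin unfolding busemann_boundary_def X_def by (simp add: closure_of_closedin)
  qed
qed

text \<open>A convergent sequence together with its limit is closed, so a horofunction in the closure of
  the \<^term>\<open>b (\<gamma> n)\<close> must be their limit.\<close>

lemma horofunction_in_closure_of_geodesic:
  assumes conv: "converges_to \<gamma> f" and h: "h \<in> horofunction_boundary G S"
    and cl: "h \<in> lipschitz_topology G S closure_of (range (\<lambda>n. b (\<gamma> n)))"
  shows "h = f"
proof (rule ccontr)
  let ?X = "lipschitz_topology G S"
  assume "h \<noteq> f"
  have lip: "h \<in> lipschitz_functions G S"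
    using cl topspace_lipschitz by (metis in_closure_of)
  then have "\<exists>y\<in>carrier G. h y \<noteq> f y"
    using \<open>h \<noteq> f\<close> conv extensionalityI[of h "carrier G" f]
    by (auto simp: lipschitz_functions_def converges_to_def)
  then obtain y where y: "y \<in> carrier G" "h y \<noteq> f y" by blast
  obtain N where N: "\<And>n. N \<le> n \<Longrightarrow> b (\<gamma> n) y = f y"
    using converges_toD[OF conv y(1)] unfolding eventually_sequentially by blast
  define A where "A = (\<lambda>n. b (\<gamma> n)) ` {..<N}"
  define C where "C = {g \<in> topspace ?X. g y \<in> {f y}}"
  have b_top: "b (\<gamma> n) \<in> topspace ?X" for n
    using b_lipschitz topspace_lipschitz converges_to_carrier[OF conv] by simp
  have "continuous_map ?X euclideanreal (\<lambda>g. g y)"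
    unfolding lipschitz_topology_def
    by (intro continuous_map_from_subtopology continuous_map_product_projection y(1))
  then have "closedin ?X C"
    unfolding C_def by (rule closedin_continuous_map_preimage) simp
  moreover have "finite A" "A \<subseteq> topspace ?X" using b_top by (auto simp: A_def)
  then have "closedin ?X A"
    using Hausdorff_imp_t1_space[OF Hausdorff_lipschitz_topology]
    by (simp add: t1_space_closedin_finite)
  ultimately have "closedin ?X (A \<union> C)" by blast
  moreover have "range (\<lambda>n. b (\<gamma> n)) \<subseteq> A \<union> C"
  proof
    fix g assume "g \<in> range (\<lambda>n. b (\<gamma> n))"
    then obtain n where "g = b (\<gamma> n)" by blast
    then show "g \<in> A \<union> C"
      using N[of n] b_top by (cases "n < N") (auto simp: A_def C_def)
  qed
  ultimately have "h \<in> A \<union> C" using cl closure_of_minimal by blast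
  moreover have "h \<notin> A"
    using h conv by (auto simp: horofunction_boundary_def A_def converges_to_def)
  ultimately show False using y by (simp add: C_def)
qed

text \<open>If finitely many geodesics cover the group, then the \<^term>\<open>b x\<close> lie on finitely many convergent
  sequences, and the boundary consists of the limits of these.\<close>

lemma boundary_if_covered_by_geodesics:
  assumes fin: "finite \<G>" and geo: "\<forall>\<gamma>\<in>\<G>. cayley_geodesic G S \<gamma>"
    and cover: "carrier G \<subseteq> (\<Union>\<gamma>\<in>\<G>. range \<gamma>)"
  shows "finite (horofunction_boundary G S)"
    and "horofunction_boundary G S \<subseteq> busemann_points G S"
proof -
  let ?X = "lipschitz_topology G S"
  have "\<forall>\<gamma>\<in>\<G>. \<exists>f. converges_to \<gamma> f \<and> f \<in> busemann_points G S"
    using geodesic_converges geo by metis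
  then obtain F where F: "\<And>\<gamma>. \<gamma> \<in> \<G> \<Longrightarrow> converges_to \<gamma> (F \<gamma>)"
      "\<And>\<gamma>. \<gamma> \<in> \<G> \<Longrightarrow> F \<gamma> \<in> busemann_points G S"
    by metis
  have "horofunction_boundary G S \<subseteq> F ` \<G>"
  proof
    fix h assume h: "h \<in> horofunction_boundary G S"
    have "b ` carrier G \<subseteq> \<Union> ((\<lambda>\<gamma>. range (\<lambda>n. b (\<gamma> n))) ` \<G>)" using cover by blast
    then have "h \<in> ?X closure_of (\<Union> ((\<lambda>\<gamma>. range (\<lambda>n. b (\<gamma> n))) ` \<G>))"
      using h closure_of_mono
      unfolding horofunction_boundary_def horofunction_compactification_def by blast
    then obtain \<gamma> where "\<gamma> \<in> \<G>" "h \<in> ?X closure_of (range (\<lambda>n. b (\<gamma> n)))"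
      using fin by (auto simp: closure_of_Union)
    then show "h \<in> F ` \<G>"
      using horofunction_in_closure_of_geodesic F(1) h by blast
  qed
  then show "finite (horofunction_boundary G S)"
    and "horofunction_boundary G S \<subseteq> busemann_points G S"
    using fin F(2) finite_surj by blast+
qed

end

section \<open>Translations of functions and their fixers\<close>

context group
begin

text \<open>The right action of \<^term>\<open>G\<close> by left translation of the argument, renormalised to vanish
  at \<^term>\<open>\<one>\<close>.\<close>

definition shift :: "('a \<Rightarrow> real) \<Rightarrow> 'a \<Rightarrow> 'a \<Rightarrow> real" where
  "shift f x = (\<lambda>y\<in>carrier G. f (x \<otimes> y) - f x)"

definition fixer :: "('a \<Rightarrow> real) set \<Rightarrow> 'a set" where
  "fixer \<O> = {z \<in> carrier G. \<forall>f\<in>\<O>. shift f z = f}"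

lemma shift_eq: "y \<in> carrier G \<Longrightarrow> shift f x y = f (x \<otimes> y) - f x"
  by (simp add: shift_def)

lemma shift_shift:
  assumes "x \<in> carrier G" "z \<in> carrier G"
  shows "shift (shift f x) z = shift f (x \<otimes> z)"
  using assms by (auto simp: shift_def m_assoc restrict_def)

lemma shift_one: "f \<in> extensional (carrier G) \<Longrightarrow> f \<one> = 0 \<Longrightarrow> shift f \<one> = f"
  by (rule extensionalityI[of _ "carrier G"]) (auto simp: shift_def)

lemma fixer_carrier: "z \<in> fixer \<O> \<Longrightarrow> z \<in> carrier G"
  by (simp add: fixer_def)

text \<open>The normalisation makes \<^term>\<open>shift f \<one> = f\<close>, so that inverses stay in the fixer.\<close>

lemma subgroup_fixer:
  assumes norm: "\<And>f. f \<in> \<O> \<Longrightarrow> f \<in> extensional (carrier G) \<and> f \<one> = 0"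
  shows "subgroup (fixer \<O>) G"
proof (rule subgroupI)
  show "fixer \<O> \<subseteq> carrier G" using fixer_carrier by blast
  have "\<one> \<in> fixer \<O>" using norm shift_one by (simp add: fixer_def)
  then show "fixer \<O> \<noteq> {}" by blast
  fix x assume x: "x \<in> fixer \<O>"
  have "shift f (inv x) = f" if f: "f \<in> \<O>" for f
  proof -
    have "shift f (inv x) = shift (shift f x) (inv x)" using x f by (simp add: fixer_def)
    also have "\<dots> = shift f (x \<otimes> inv x)"
      using fixer_carrier[OF x] by (simp add: shift_shift)
    also have "\<dots> = f" using fixer_carrier[OF x] norm[OF f] shift_one by simp
    finally show ?thesis .
  qed
  then show "inv x \<in> fixer \<O>" using x by (simp add: fixer_def)
  fix y assume y: "y \<in> fixer \<O>"
  have "shift f (x \<otimes> y) = f" if "f \<in> \<O>" for f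
    using x y that shift_shift[of x y f, symmetric] by (simp add: fixer_def)
  then show "x \<otimes> y \<in> fixer \<O>" using x y by (simp add: fixer_def)
qed

text \<open>The fixer is the kernel of the action on a finite set, so only finitely many
  transformations \<open>\<Phi> x\<close> of that set occur, and each coset is determined by one of them.\<close>

lemma finite_rcosets_fixer:
  assumes fin: "finite \<O>"
    and norm: "\<And>f. f \<in> \<O> \<Longrightarrow> f \<in> extensional (carrier G) \<and> f \<one> = 0"
    and inv: "\<And>f x. f \<in> \<O> \<Longrightarrow> x \<in> carrier G \<Longrightarrow> shift f x \<in> \<O>"
  shows "finite (rcosets fixer \<O>)"
proof -
  note sub = subgroup_fixer[OF norm]
  define \<Phi> where "\<Phi> x = (\<lambda>f\<in>\<O>. shift f x)" for x
  have same_coset: "fixer \<O> #> x = fixer \<O> #> y"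
    if xy: "x \<in> carrier G" "y \<in> carrier G" and eq: "\<Phi> x = \<Phi> y" for x y
  proof -
    have "shift f (x \<otimes> inv y) = f" if f: "f \<in> \<O>" for f
    proof -
      have "shift f x = shift f y" using eq f unfolding \<Phi>_def by (metis restrict_apply')
      then have "shift f (x \<otimes> inv y) = shift (shift f y) (inv y)"
        using xy by (simp add: shift_shift[symmetric])
      also have "\<dots> = f" using xy f norm shift_one by (simp add: shift_shift)
      finally show ?thesis .
    qed
    then have "x \<otimes> inv y \<in> fixer \<O>" using xy by (simp add: fixer_def)
    moreover have "x = (x \<otimes> inv y) \<otimes> y" using xy by (simp add: m_assoc)
    ultimately have "x \<in> fixer \<O> #> y" unfolding r_coset_def by blast
    then show ?thesis using repr_independence[OF _ xy(2) sub] by simp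
  qed
  have "\<Phi> ` carrier G \<subseteq> \<O> \<rightarrow>\<^sub>E \<O>" using inv by (auto simp: \<Phi>_def)
  then have "finite (\<Phi> ` carrier G)" using fin finite_subset finite_PiE by metis
  moreover have "rcosets fixer \<O>
      \<subseteq> (\<lambda>v. fixer \<O> #> (SOME x. x \<in> carrier G \<and> \<Phi> x = v)) ` (\<Phi> ` carrier G)"
  proof
    fix R assume "R \<in> rcosets fixer \<O>"
    then obtain x where x: "x \<in> carrier G" "R = fixer \<O> #> x" by (auto simp: RCOSETS_def)
    define y where "y = (SOME y. y \<in> carrier G \<and> \<Phi> y = \<Phi> x)"
    have "y \<in> carrier G \<and> \<Phi> y = \<Phi> x" unfolding y_def by (rule someI) (use x in auto)
    then have "R = fixer \<O> #> y" using same_coset x by metis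
    then show "R \<in> (\<lambda>v. fixer \<O> #> (SOME x. x \<in> carrier G \<and> \<Phi> x = v)) ` (\<Phi> ` carrier G)"
      unfolding y_def using x by blast
  qed
  ultimately show ?thesis by (rule finite_subset[OF _ finite_imageI, rotated])
qed

lemma fixer_additive:
  assumes "z \<in> fixer \<O>" "f \<in> \<O>" "y \<in> carrier G"
  shows "f (z \<otimes> y) = f z + f y"
  using shift_eq[of y f z] assms by (simp add: fixer_def)

lemma fixer_inv:
  assumes "z \<in> fixer \<O>" "f \<in> \<O>" "f \<one> = 0"
  shows "f (inv z) = - f z"
  using fixer_additive[of z \<O> f "inv z"] assms fixer_carrier by simp

lemma fixer_nat_pow:
  assumes "z \<in> fixer \<O>" "f \<in> \<O>" "f \<one> = 0"
  shows "f (z [^] (n::nat)) = real n * f z"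
proof (induction n)
  case (Suc n)
  have z: "z \<in> carrier G" using assms fixer_carrier by blast
  have "f (z [^] Suc n) = f (z \<otimes> z [^] n)" by (simp only: nat_pow_Suc2[OF z])
  also have "\<dots> = f z + f (z [^] n)" using fixer_additive assms z by simp
  finally show ?case using Suc by (simp add: algebra_simps)
qed (use assms in simp)

lemma fixer_int_pow:
  assumes "subgroup (fixer \<O>) G" "z \<in> fixer \<O>" "f \<in> \<O>" "f \<one> = 0"
  shows "f (z [^] (j::int)) = of_int j * f z"
proof (cases j rule: int_cases2)
  case (nonneg n)
  then show ?thesis using fixer_nat_pow assms by (simp add: int_pow_int)
next
  case (nonpos n)
  have "z [^] n \<in> fixer \<O>"
    using assms subgroup_int_pow_closed int_pow_int by metis
  then have "f (inv (z [^] n)) = - f (z [^] n)" using fixer_inv assms by blast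
  then show ?thesis
    using nonpos assms fixer_nat_pow fixer_carrier by (simp add: int_pow_neg int_pow_int)
qed

text \<open>Division with remainder: an element of least positive height generates.\<close>

lemma cyclic_group_if_injective_height:
  fixes h :: "'a \<Rightarrow> real"
  assumes sub: "subgroup L G"
    and ints: "\<And>x. x \<in> L \<Longrightarrow> h x \<in> \<int>"
    and add: "\<And>x y. x \<in> L \<Longrightarrow> y \<in> L \<Longrightarrow> h (x \<otimes> y) = h x + h y"
    and inj: "\<And>x. x \<in> L \<Longrightarrow> h x = 0 \<Longrightarrow> x = \<one>"
  shows "cyclic_group (G\<lparr>carrier := L\<rparr>)"
proof -
  interpret L: subgroup L G by (rule sub)
  interpret GL: group "G\<lparr>carrier := L\<rparr>" by (rule L.subgroup_is_group[OF group_axioms])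
  have h1: "h \<one> = 0" using add[of \<one> \<one>] by simp
  have hinv: "h (inv x) = - h x" if "x \<in> L" for x
    using add[of x "inv x"] that h1 L.mem_carrier by simp
  have "\<exists>z\<in>L. L \<subseteq> range (\<lambda>n::int. z [^] n)"
  proof (cases "\<exists>x\<in>L. h x \<noteq> 0")
    case False
    then have "L \<subseteq> range (\<lambda>n::int. \<one> [^] n)" using inj by auto
    then show ?thesis using L.one_closed by blast
  next
    case True
    then have "\<exists>x. x \<in> L \<and> 0 < h x"
      using hinv L.m_inv_closed by (metis linorder_neqE neg_0_less_iff_less)
    then obtain z where z: "z \<in> L" "0 < h z"
        and least: "\<And>y. y \<in> L \<and> 0 < h y \<Longrightarrow> nat \<lfloor>h z\<rfloor> \<le> nat \<lfloor>h y\<rfloor>"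
      using ex_has_least_nat[of "\<lambda>x. x \<in> L \<and> 0 < h x" _ "\<lambda>x. nat \<lfloor>h x\<rfloor>"] by blast
    have hpow: "h (z [^] j) = of_int j * h z" for j :: int
    proof -
      have nat: "h (z [^] n) = real n * h z \<and> z [^] n \<in> L" for n :: nat
        by (induction n) (use add z h1 in \<open>auto simp: algebra_simps\<close>)
      show ?thesis
        using nat hinv z L.mem_carrier
        by (cases j rule: int_cases2) (auto simp: int_pow_int int_pow_neg)
    qed
    have "y \<in> range (\<lambda>n::int. z [^] n)" if y: "y \<in> L" for y
    proof -
      define j where "j = \<lfloor>h y / h z\<rfloor>"
      define r where "r = y \<otimes> inv (z [^] j)"
      have zj: "z [^] j \<in> L" using subgroup_int_pow_closed[OF sub z(1)] .
      then have r: "r \<in> L" using y by (simp add: r_def)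
      have hr: "h r = h y - of_int j * h z" using add[of y "inv (z [^] j)"] hinv zj y hpow
        by (simp add: r_def)
      have "of_int j \<le> h y / h z" "h y / h z < of_int j + 1" unfolding j_def by linarith+
      then have "0 \<le> h r" "h r < h z" using z(2) by (simp_all add: hr field_simps)
      moreover have "h z \<le> h r" if "0 < h r"
      proof -
        have "0 \<le> \<lfloor>h r\<rfloor>" using that by simp
        then have "\<lfloor>h z\<rfloor> \<le> \<lfloor>h r\<rfloor>" using least[of r] r that by linarith
        then show ?thesis using ints[OF r] ints[OF z(1)] by (auto elim!: Ints_cases)
      qed
      ultimately have "h r = 0" by linarith
      then have "y \<otimes> inv (z [^] j) = \<one>" using inj r r_def by blast
      then have "y = z [^] j" using y zj L.mem_carrier
        by (metis inv_closed inv_equality inv_inv)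
      then show ?thesis by blast
    qed
    then show ?thesis using z by blast
  qed
  then obtain z where z: "z \<in> L" "L \<subseteq> range (\<lambda>n::int. z [^] n)" by blast
  have "L = range (\<lambda>n::int. z [^]\<^bsub>G\<lparr>carrier := L\<rparr>\<^esub> n)"
    using z subgroup_int_pow_closed[OF sub z(1)] int_pow_consistent[OF sub z(1)] by auto
  then show ?thesis using z by (auto simp: GL.cyclic_group)
qed

end

context cayley_graph
begin

lemma busemann_point_normalised:
  "f \<in> busemann_points G S \<Longrightarrow> f \<in> extensional (carrier G) \<and> f \<one> = 0"
  using busemann_point_lipschitz by (auto simp: lipschitz_functions_def)

text \<open>Translating a geodesic translates its Busemann point.\<close>

lemma shift_busemann_point:
  assumes f: "f \<in> busemann_points G S" and x: "x \<in> carrier G"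
  shows "shift f x \<in> busemann_points G S"
proof -
  obtain \<gamma> where geo: "cayley_geodesic G S \<gamma>" and conv: "converges_to \<gamma> f"
    using busemann_pointE[OF f] .
  define \<delta> where "\<delta> n = inv x \<otimes> \<gamma> n" for n
  have \<gamma>: "\<gamma> n \<in> carrier G" for n using geodesic_carrier[OF geo] .
  have geo': "cayley_geodesic G S \<delta>"
    using geo \<gamma> x by (auto simp: cayley_geodesic_def \<delta>_def)
  have dist: "d (\<delta> n) y = d (\<gamma> n) (x \<otimes> y)" if "y \<in> carrier G" for n y
    using dist_translate[of x "\<delta> n" y] x \<gamma> that by (simp add: \<delta>_def m_assoc[symmetric])
  have "converges_to \<delta> (shift f x)"
    unfolding converges_to_def
  proof (intro conjI ballI)
    fix y assume y: "y \<in> carrier G"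
    show "\<forall>\<^sub>F n in sequentially. b (\<delta> n) y = shift f x y"
      using converges_toD[OF conv m_closed[OF x y]] converges_toD[OF conv x]
    proof eventually_elim
      case (elim n)
      then show ?case using x y by (simp add: b_eq shift_eq dist)
    qed
  qed (use \<gamma> x in \<open>auto simp: \<delta>_def shift_def\<close>)
  moreover obtain g where "converges_to \<delta> g" "g \<in> busemann_points G S"
    using geodesic_converges[OF geo'] .
  ultimately show ?thesis using converges_to_unique by blast
qed

end

section \<open>Finitely many Busemann points force the group to be virtually cyclic\<close>

context cayley_graph
begin

text \<open>If all Busemann points vanish on the fixer, then each is constant on its finitely many
  cosets; but along its own geodesic a Busemann point takes infinitely many values.\<close>

lemma busemann_point_nontrivial_on_fixer:
  assumes fin: "finite (busemann_points G S)" and inf: "infinite (carrier G)"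
  obtains t f where "t \<in> fixer (busemann_points G S)" "f \<in> busemann_points G S" "f t \<noteq> 0"
proof -
  let ?H = "fixer (busemann_points G S)"
  have sub: "subgroup ?H G" by (rule subgroup_fixer[OF busemann_point_normalised])
  have index: "finite (rcosets ?H)"
    by (rule finite_rcosets_fixer[OF fin busemann_point_normalised shift_busemann_point])
  obtain \<gamma> where geo: "cayley_geodesic G S \<gamma>" "\<gamma> 0 = \<one>" using geodesic_ray_exists[OF inf] .
  obtain f where conv: "converges_to \<gamma> f" and f: "f \<in> busemann_points G S"
    using geodesic_converges[OF geo(1)] .
  have "\<exists>t\<in>?H. f t \<noteq> 0"
  proof (rule ccontr)
    assume "\<not> (\<exists>t\<in>?H. f t \<noteq> 0)"
    then have zero: "f t = 0" if "t \<in> ?H" for t using that by blast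
    have "f ` carrier G \<subseteq> (\<lambda>R. f (SOME x. x \<in> R)) ` (rcosets ?H)"
    proof
      fix v assume "v \<in> f ` carrier G"
      then obtain x where x: "x \<in> carrier G" "v = f x" by blast
      let ?y = "SOME y. y \<in> ?H #> x"
      have "?y \<in> ?H #> x" by (rule someI) (rule rcos_self[OF x(1) sub])
      then obtain t where t: "t \<in> ?H" "?y = t \<otimes> x" by (auto simp: r_coset_def)
      then have "f ?y = v" using fixer_additive[OF t(1) f x(1)] zero x by simp
      moreover have "?H #> x \<in> rcosets ?H" using x by (auto simp: RCOSETS_def)
      ultimately show "v \<in> (\<lambda>R. f (SOME x. x \<in> R)) ` (rcosets ?H)" by blast
    qed
    then have "finite (f ` carrier G)" using index finite_surj by blast
    moreover have "range (\<lambda>n. f (\<gamma> n)) \<subseteq> f ` carrier G" using geodesic_carrier[OF geo(1)] by blast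
    ultimately have "finite (range (\<lambda>n. f (\<gamma> n)))" by (rule rev_finite_subset)
    moreover have "inj (\<lambda>n. f (\<gamma> n))"
    proof (rule injI)
      fix m n assume "f (\<gamma> m) = f (\<gamma> n)"
      then show "m = n"
        using converges_to_along_geodesic[OF geo(1) conv, of m]
          converges_to_along_geodesic[OF geo(1) conv, of n] by simp
    qed
    ultimately show False using finite_imageD[of "\<lambda>n. f (\<gamma> n)" UNIV] by simp
  qed
  then show thesis using that f by blast
qed

text \<open>The choice of \<^term>\<open>h\<close> as the Busemann point that is largest at \<^term>\<open>t\<close> in absolute value bounds
  the effect on \<^term>\<open>h\<close> of right multiplication by \<^term>\<open>t\<close> anywhere in the group.\<close>

lemma extremal_busemann_point:
  assumes fin: "finite (busemann_points G S)" and inf: "infinite (carrier G)"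
  obtains t h where "t \<in> fixer (busemann_points G S)" "h \<in> busemann_points G S"
    "h t \<le> -1" "\<forall>f\<in>busemann_points G S. \<bar>f t\<bar> \<le> - h t"
proof -
  let ?B = "busemann_points G S"
  have sub: "subgroup (fixer ?B) G" by (rule subgroup_fixer[OF busemann_point_normalised])
  obtain t f where t: "t \<in> fixer ?B" and f: "f \<in> ?B" "f t \<noteq> 0"
    using busemann_point_nontrivial_on_fixer[OF assms] .
  define p where "p = Max ((\<lambda>g. \<bar>g t\<bar>) ` ?B)"
  have "p \<in> (\<lambda>g. \<bar>g t\<bar>) ` ?B" unfolding p_def using fin f by (intro Max_in) auto
  then obtain h where h: "h \<in> ?B" "p = \<bar>h t\<bar>" by blast
  have max: "\<bar>g t\<bar> \<le> \<bar>h t\<bar>" if "g \<in> ?B" for g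
    using fin that unfolding h(2)[symmetric] p_def by (intro Max_ge) auto
  have "h t \<noteq> 0" using max[OF f(1)] f(2) by auto
  have inv: "g (inv t) = - g t" if "g \<in> ?B" for g
    using fixer_inv[OF t that] busemann_point_normalised[OF that] by simp
  define u where "u = (if h t < 0 then t else inv t)"
  have u: "u \<in> fixer ?B" using t subgroup.m_inv_closed[OF sub t] by (simp add: u_def)
  have "h u < 0" using inv[OF h(1)] \<open>h t \<noteq> 0\<close> by (simp add: u_def)
  moreover have "\<forall>g\<in>?B. \<bar>g u\<bar> \<le> - h u"
  proof
    fix g assume that: "g \<in> ?B"
    show "\<bar>g u\<bar> \<le> - h u"
      using max[OF that] inv[OF that] inv[OF h(1)] by (auto simp: u_def)
  qed
  moreover have "h u \<in> \<int>" using busemann_point_Ints[OF h(1)] u fixer_carrier by blast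
  ultimately show thesis using that[OF u h(1)] by (auto elim!: Ints_cases)
qed

text \<open>Equality in the Lipschitz estimate along a geodesic forces every edge to be extremal.\<close>

lemma extremal_path:
  fixes h :: "'a \<Rightarrow> real"
  assumes edge: "\<And>x s. x \<in> carrier G \<Longrightarrow> s \<in> S \<Longrightarrow> h (x \<otimes> s) - h x \<le> c"
    and ext: "\<And>x s. x \<in> carrier G \<Longrightarrow> s \<in> S \<Longrightarrow> h (x \<otimes> s) - h x = c
        \<Longrightarrow> \<exists>j::int. s = t [^] j"
    and t: "t \<in> carrier G" and x: "x \<in> carrier G" and y: "y \<in> carrier G"
    and max: "h y - h x \<ge> c * real (d x y)"
  shows "\<exists>j::int. y = x \<otimes> t [^] j"
  using x max
proof (induction "d x y" arbitrary: x)
  case 0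
  then have "y = x \<otimes> t [^] (0::int)" using dist_eq_0D y by auto
  then show ?case by blast
next
  case (Suc n)
  have x: "x \<in> carrier G" by fact
  obtain s where s: "s \<in> S" "d (x \<otimes> s) y = n" using dist_SucE[OF x y Suc(2)[symmetric]] .
  have xs: "x \<otimes> s \<in> carrier G" using x s S_carrier by simp
  have "c * real (d x y) = c * real n + c" by (simp add: Suc(2)[symmetric] algebra_simps)
  moreover have "h y - h (x \<otimes> s) \<le> c * real n"
    using increase_le_if_edges[OF edge xs y] s(2) by simp
  ultimately have eq: "h (x \<otimes> s) - h x = c" "c * real n \<le> h y - h (x \<otimes> s)"
    using edge[OF x s(1)] Suc.prems by linarith+
  obtain i :: int where i: "s = t [^] i" using ext[OF x s(1) eq(1)] by blast
  obtain j :: int where j: "y = x \<otimes> s \<otimes> t [^] j" using Suc(1)[of "x \<otimes> s"] s xs eq(2) by auto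
  have "y = x \<otimes> t [^] (i + j)" using i j x t by (simp add: int_pow_mult m_assoc)
  then show ?case by blast
qed

end

lemma (in group) symmetric_generating_set_add:
  assumes S: "symmetric_generating_set G S" and t: "t \<in> carrier G"
  shows "symmetric_generating_set G (S \<union> {t, inv t})"
proof -
  have inv: "(\<lambda>x. inv x) ` S = S" and SG: "S \<subseteq> carrier G" "generate G S = carrier G"
    using S by (auto simp: symmetric_generating_set_def SET_INV_def)
  have "generate G S \<subseteq> generate G (S \<union> {t, inv t})" by (rule mono_generate) auto
  moreover have "generate G (S \<union> {t, inv t}) \<subseteq> carrier G" using SG t by (intro generate_incl) auto
  moreover have "set_inv (S \<union> {t, inv t}) = (\<lambda>x. inv x) ` S \<union> {inv t, inv (inv t)}"
    by (auto simp: SET_INV_def)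
  ultimately show ?thesis
    using S t SG inv by (auto simp: symmetric_generating_set_def)
qed

lemma (in group) virtually_Z_if_finite_busemann_points:
  assumes inf: "infinite (carrier G)"
    and S0: "symmetric_generating_set G S0"
    and fin: "\<And>S. symmetric_generating_set G S \<Longrightarrow> finite (busemann_points G S)"
  shows "virtually_Z G"
proof -
  interpret A: cayley_graph G S0 by unfold_locales (rule S0)
  let ?B = "busemann_points G S0"
  obtain t h where t: "t \<in> fixer ?B" and h: "h \<in> ?B" and ht: "h t \<le> -1"
    and max: "\<forall>f\<in>?B. \<bar>f t\<bar> \<le> - h t"
    by (rule A.extremal_busemann_point[OF fin[OF S0] inf])
  have tG: "t \<in> carrier G" using t fixer_carrier by blast
  have h1: "h \<one> = 0" using A.busemann_point_normalised h by blast
  \<comment> \<open>Largest change of \<open>h\<close> along an edge labelled \<open>t\<^sup>2\<close>. Taking the square makes it at least two,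
    hence strictly larger than the change along any edge of the old graph.\<close>
  define c where "c = - 2 * h t"
  define u where "u = t [^] (2::int)"
  define S where "S = S0 \<union> {u, inv u}"
  have c: "2 \<le> c" using ht by (simp add: c_def)
  have uG: "u \<in> carrier G" using tG by (simp add: u_def)
  have S: "symmetric_generating_set G S"
    unfolding S_def by (rule symmetric_generating_set_add[OF S0 uG])
  interpret C: cayley_graph G S by unfold_locales (rule S)
  have subB: "subgroup (fixer ?B) G" by (rule subgroup_fixer[OF A.busemann_point_normalised])
  have uB: "u \<in> fixer ?B" unfolding u_def by (rule subgroup_int_pow_closed[OF subB t])
  have hu: "f u = 2 * f t" if "f \<in> ?B" for f
    using fixer_int_pow[OF subB t that] A.busemann_point_normalised[OF that] by (simp add: u_def)
  have edge0: "\<bar>h (x \<otimes> s) - h x\<bar> \<le> 1" if "x \<in> carrier G" "s \<in> S0" for x s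
  proof -
    have "\<bar>h (x \<otimes> s) - h x\<bar> \<le> real (A.d (x \<otimes> s) x)"
      using A.busemann_point_lipschitz[OF h] that A.S_carrier by (simp add: lipschitz_functions_def)
    then show ?thesis using A.dist_generator[OF that] A.dist_sym[of x "x \<otimes> s"] by linarith
  qed
  \<comment> \<open>The increment of \<open>h\<close> at \<open>x\<close> is the value of the translated Busemann point, to which the
    extremality of \<open>h\<close> at \<open>t\<close> applies.\<close>
  have edge_u: "\<bar>h (x \<otimes> s) - h x\<bar> \<le> c" if x: "x \<in> carrier G" and s: "s \<in> {u, inv u}" for x s
  proof -
    have B: "shift h x \<in> ?B" by (rule A.shift_busemann_point[OF h x])
    have "shift h x (inv u) = - shift h x u"
      using fixer_inv[OF uB B] A.busemann_point_normalised[OF B] by simp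
    then have "\<bar>shift h x s\<bar> = 2 * \<bar>shift h x t\<bar>" using s hu[OF B] by auto
    then show ?thesis using bspec[OF max B] shift_eq[of s h x] s uG by (auto simp: c_def)
  qed
  have edge: "\<bar>h (x \<otimes> s) - h x\<bar> \<le> c" if "x \<in> carrier G" "s \<in> S" for x s
    using edge0[of x s] edge_u[of x s] that c by (auto simp: S_def)
  have lip: "\<bar>h x - h y\<bar> \<le> c * real (C.d x y)" if "x \<in> carrier G" "y \<in> carrier G" for x y
  proof -
    have up: "h (z \<otimes> s) - h z \<le> c" if "z \<in> carrier G" "s \<in> S" for z s
      using edge[OF that] by linarith
    show ?thesis
      using C.increase_le_if_edges[where f = h, OF up that]
        C.increase_le_if_edges[where f = h, OF up that(2,1)] C.dist_sym[of x y] by simp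
  qed
  have hpow: "h (u [^] n) = - c * real n" for n :: nat
    using fixer_nat_pow[OF uB h h1, of n] hu[OF h] by (simp add: c_def)
  have geo: "cayley_geodesic G S (\<lambda>n. u [^] n)"
  proof (rule C.geodesicI)
    show "C.d (u [^] n) (u [^] Suc n) \<le> 1" for n
      using C.dist_generator[of "u [^] n" u] uG by (simp add: S_def)
    have "n \<le> C.d (u [^] (0::nat)) (u [^] n)" for n
    proof -
      have "c * real n \<le> c * real (C.d \<one> (u [^] n))"
        using lip[OF one_closed, of "u [^] n"] uG hpow[of n] h1 c by simp
      then show ?thesis using c by simp
    qed
    then show "\<exists>N\<ge>n. N \<le> C.d (u [^] (0::nat)) (u [^] N)" for n by blast
  qed (use uG in simp)
  obtain k where k: "C.converges_to (\<lambda>n. u [^] n) k" "k \<in> busemann_points G S"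
    using C.geodesic_converges[OF geo] .
  have k1: "k \<one> = 0" using C.busemann_point_normalised k by blast
  have k_witness: "\<exists>n. k y = real (C.d (u [^] n) y) - real n" if y: "y \<in> carrier G" for y
  proof -
    obtain n :: nat where "C.b (u [^] n) y = k y"
      using eventually_happens'[OF sequentially_bot C.converges_toD[OF k(1) y]] by blast
    moreover have "C.d (u [^] n) \<one> = n"
      using C.geodesic_dist[OF geo, of 0 n] by simp
    ultimately show ?thesis using y by (auto simp: C.b_eq intro!: exI[of _ n])
  qed
  have h_le_k: "h y \<le> c * k y" if y: "y \<in> carrier G" for y
  proof -
    obtain n where n: "k y = real (C.d (u [^] n) y) - real n" using k_witness[OF y] by blast
    have "h y + c * real n \<le> c * real (C.d (u [^] n) y)"
      using lip[of "u [^] n" y] uG y hpow[of n] by simp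
    then show ?thesis by (simp add: n algebra_simps)
  qed
  let ?D = "?B \<union> busemann_points G S"
  let ?L = "fixer ?D"
  have normD: "\<And>f. f \<in> ?D \<Longrightarrow> f \<in> extensional (carrier G) \<and> f \<one> = 0"
    using A.busemann_point_normalised C.busemann_point_normalised by blast
  have subL: "subgroup ?L G" by (rule subgroup_fixer[OF normD])
  have index: "finite (rcosets ?L)"
  proof (rule finite_rcosets_fixer[OF _ normD])
    show "finite ?D" using fin S0 S by blast
    show "shift f x \<in> ?D" if "f \<in> ?D" "x \<in> carrier G" for f x
      using that A.shift_busemann_point C.shift_busemann_point by blast
  qed
  \<comment> \<open>An inequality between homomorphisms is an equality, as its negation holds at inverses.\<close>
  have h_eq_k: "h y = c * k y" if y: "y \<in> ?L" for y
  proof -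
    have "h (inv y) = - h y" "k (inv y) = - k y" using fixer_inv[OF y] h k h1 k1 by auto
    then show ?thesis
      using h_le_k[of y] h_le_k[of "inv y"] fixer_carrier[OF y] by simp
  qed
  have inj: "y = \<one>" if y: "y \<in> ?L" and hy: "h y = 0" for y
  proof -
    have yG: "y \<in> carrier G" using y fixer_carrier by blast
    have "k y = 0" using h_eq_k[OF y] hy c by simp
    then obtain n where n: "real (C.d (u [^] n) y) = real n" using k_witness[OF yG] by auto
    have "\<exists>j::int. y = u [^] n \<otimes> t [^] j"
    proof (rule C.extremal_path[where h = h and c = c])
      show "h (x \<otimes> s) - h x \<le> c" if "x \<in> carrier G" "s \<in> S" for x s
        using edge[OF that] by linarith
      fix x s assume xs: "x \<in> carrier G" "s \<in> S" "h (x \<otimes> s) - h x = c"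
      then have "s \<notin> S0" using edge0[of x s] c by linarith
      then have "s = t [^] (2::int) \<or> s = t [^] (- 2::int)"
        using xs tG by (auto simp: S_def u_def int_pow_neg)
      then show "\<exists>j::int. s = t [^] j" by blast
    qed (use tG uG yG n hy hpow in auto)
    then obtain j :: int where "y = u [^] n \<otimes> t [^] j" by blast
    then have yt: "y = t [^] (2 * int n + j)"
      using tG by (simp add: u_def int_pow_mult int_pow_pow int_pow_int[symmetric])
    then have "of_int (2 * int n + j) * h t = 0"
      using fixer_int_pow[OF subB t h h1] hy by simp
    then have "2 * int n + j = 0" using ht by simp
    then show ?thesis using yt by simp
  qed
  have "cyclic_group (G\<lparr>carrier := ?L\<rparr>)"
  proof (rule cyclic_group_if_injective_height[OF subL])
    show "h x \<in> \<int>" if "x \<in> ?L" for x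
      using A.busemann_point_Ints[OF h] fixer_carrier[OF that] by blast
    show "h (x \<otimes> y) = h x + h y" if "x \<in> ?L" "y \<in> ?L" for x y
      using fixer_additive[OF that(1)] h fixer_carrier[OF that(2)] by blast
  qed (rule inj)
  moreover have "infinite ?L"
  proof
    assume "finite ?L"
    then have "finite R" if "R \<in> rcosets ?L" for R
      using that by (auto simp: RCOSETS_def r_coset_def)
    then have "finite (\<Union> (rcosets ?L))" using index by blast
    then show False using inf rcosets_part_G[OF subL] by simp
  qed
  ultimately show ?thesis using subL index unfolding virtually_Z_def by blast
qed

section \<open>Virtually infinite cyclic groups\<close>

context group
begin

text \<open>The subgroup generated by \<^term>\<open>c\<close> has finite index, with \<^term>\<open>R\<close> a finite set
  of representatives, possibly repeated, for its right cosets.\<close>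

definition covers_by_powers :: "'a \<Rightarrow> 'a set \<Rightarrow> bool" where
  "covers_by_powers c R \<longleftrightarrow> finite R \<and> R \<subseteq> carrier G \<and>
     (\<forall>x\<in>carrier G. \<exists>k::int. \<exists>r\<in>R. x = c [^] k \<otimes> r)"

text \<open>The subgroup generated by \<^term>\<open>c\<close> is infinite cyclic, normal and of finite index. Normality
  is stated for the generator, which can only go to one of the two generators.\<close>

definition virtual_axis :: "'a \<Rightarrow> bool" where
  "virtual_axis c \<longleftrightarrow> c \<in> carrier G \<and> (\<forall>n::int. c [^] n = \<one> \<longrightarrow> n = 0) \<and>
     (\<forall>g\<in>carrier G. g \<otimes> c \<otimes> inv g \<in> {c, inv c}) \<and> (\<exists>R. covers_by_powers c R)"

lemma conj_int_pow:
  assumes "g \<in> carrier G" "x \<in> carrier G"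
  shows "g \<otimes> x [^] (n::int) \<otimes> inv g = (g \<otimes> x \<otimes> inv g) [^] n"
proof -
  have "(\<lambda>y. g \<otimes> y \<otimes> inv g) \<in> hom G G"
    using assms by (auto simp: hom_def m_assoc inv_solve_left)
  from hom_int_pow[OF this assms(2) group_axioms group_axioms] show ?thesis by simp
qed

lemma int_pow_eq_iff:
  assumes "c \<in> carrier G" "\<And>n::int. c [^] n = \<one> \<Longrightarrow> n = 0"
  shows "c [^] (m::int) = c [^] n \<longleftrightarrow> m = n"
  using assms int_pow_diff[of c m n] by fastforce

lemma covers_by_powers_int_pow:
  assumes cov: "covers_by_powers c R" and c: "c \<in> carrier G" and e: "e \<noteq> (0::int)"
  shows "\<exists>R'. covers_by_powers (c [^] e) R'"
proof
  let ?R' = "(\<lambda>(i, r). c [^] i \<otimes> r) ` ({- \<bar>e\<bar>..\<bar>e\<bar>} \<times> R)"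
  have "\<exists>k::int. \<exists>r\<in>?R'. x = (c [^] e) [^] k \<otimes> r" if x: "x \<in> carrier G" for x
  proof -
    obtain k :: int and r where r: "r \<in> R" "x = c [^] k \<otimes> r"
      using cov x by (auto simp: covers_by_powers_def)
    have "r \<in> carrier G" using cov r by (auto simp: covers_by_powers_def)
    moreover have "c [^] k = c [^] (e * (k div e)) \<otimes> c [^] (k mod e)"
      using int_pow_mult[OF c, of "e * (k div e)" "k mod e"] by simp
    ultimately have "x = (c [^] e) [^] (k div e) \<otimes> (c [^] (k mod e) \<otimes> r)"
      using r c by (simp add: int_pow_pow m_assoc)
    moreover have "k mod e \<in> {- \<bar>e\<bar>..\<bar>e\<bar>}" using abs_mod_less[OF e, of k] by auto
    ultimately show ?thesis
      using r(1) by (intro exI[of _ "k div e"] bexI[of _ "c [^] (k mod e) \<otimes> r"]) auto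
  qed
  moreover have "finite ?R'" using cov by (simp add: covers_by_powers_def)
  moreover have "?R' \<subseteq> carrier G" using cov c by (auto simp: covers_by_powers_def)
  ultimately show "covers_by_powers (c [^] e) ?R'" by (simp add: covers_by_powers_def)
qed

lemma virtual_axis_int_pow:
  assumes "virtual_axis c" "e \<noteq> (0::int)"
  shows "virtual_axis (c [^] e)"
proof -
  have c: "c \<in> carrier G" using assms by (simp add: virtual_axis_def)
  have "g \<otimes> c [^] e \<otimes> inv g \<in> {c [^] e, inv (c [^] e)}" if "g \<in> carrier G" for g
  proof -
    have "g \<otimes> c \<otimes> inv g \<in> {c, inv c}" using assms that by (simp add: virtual_axis_def)
    then show ?thesis using that c by (auto simp: conj_int_pow int_pow_inv)
  qed
  moreover have "n = 0" if "(c [^] e) [^] n = \<one>" for n :: int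
  proof -
    have "c [^] (e * n) = \<one>" using that c by (simp add: int_pow_pow)
    then have "e * n = 0" using assms unfolding virtual_axis_def by blast
    then show ?thesis using assms by simp
  qed
  moreover have "\<exists>R. covers_by_powers (c [^] e) R"
    using covers_by_powers_int_pow assms c by (auto simp: virtual_axis_def)
  ultimately show ?thesis using c by (simp add: virtual_axis_def)
qed

lemma virtually_Z_generator:
  assumes "virtually_Z G"
  obtains a R where "a \<in> carrier G" "\<forall>n::int. a [^] n = \<one> \<longrightarrow> n = 0" "covers_by_powers a R"
proof -
  obtain H where sub: "subgroup H G" and fin: "finite (rcosets H)" and inf: "infinite H"
    and cyc: "cyclic_group (G\<lparr>carrier := H\<rparr>)"
    using assms by (auto simp: virtually_Z_def)
  interpret H: group "G\<lparr>carrier := H\<rparr>" by (rule subgroup.subgroup_is_group[OF sub group_axioms])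
  obtain a where a: "a \<in> H" "H = range (\<lambda>n::int. a [^]\<^bsub>G\<lparr>carrier := H\<rparr>\<^esub> n)"
    using cyc by (auto simp: H.cyclic_group)
  then have H: "H = range (\<lambda>n::int. a [^] n)" using int_pow_consistent[OF sub a(1)] by simp
  have aG: "a \<in> carrier G" using a(1) subgroup.mem_carrier[OF sub] by simp
  have order: "n = 0" if "a [^] n = \<one>" for n :: int
  proof (rule ccontr)
    assume n: "n \<noteq> 0"
    have "a [^] k = a [^] (k mod n)" for k :: int
    proof -
      have "a [^] k = (a [^] n) [^] (k div n) \<otimes> a [^] (k mod n)"
        using int_pow_mult[OF aG, of "n * (k div n)" "k mod n"] aG by (simp add: int_pow_pow)
      then show ?thesis using that aG by simp
    qed
    moreover have "k mod n \<in> {- \<bar>n\<bar>..\<bar>n\<bar>}" for k using abs_mod_less[OF n, of k] by auto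
    ultimately have "H \<subseteq> (\<lambda>i. a [^] i) ` {- \<bar>n\<bar>..\<bar>n\<bar>}" unfolding H by blast
    then have "finite H" by (rule finite_subset) simp
    then show False using inf by simp
  qed
  define R where "R = (\<lambda>C. SOME x. x \<in> C) ` (rcosets H)"
  have some: "(SOME y. y \<in> H #> x) \<in> H #> x" if "x \<in> carrier G" for x
    by (rule someI) (rule rcos_self[OF that sub])
  have "covers_by_powers a R"
    unfolding covers_by_powers_def
  proof (intro conjI ballI)
    show "finite R" using fin by (simp add: R_def)
    show "R \<subseteq> carrier G"
      using some r_coset_subset_G[OF subgroup.subset[OF sub]] by (auto simp: R_def RCOSETS_def)
    fix x assume x: "x \<in> carrier G"
    define r where "r = (SOME y. y \<in> H #> x)"
    have r: "r \<in> H #> x" "r \<in> R" using some[OF x] x by (auto simp: r_def R_def RCOSETS_def)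
    then obtain k :: int where k: "r = a [^] k \<otimes> x" using H by (auto simp: r_coset_def)
    then have "x = a [^] (- k) \<otimes> r" using aG x by (simp add: int_pow_neg m_assoc[symmetric])
    then show "\<exists>k::int. \<exists>r\<in>R. x = a [^] k \<otimes> r" using r by blast
  qed
  then show thesis using that aG order by blast
qed

text \<open>Two of more than \<^term>\<open>card R\<close> elements lie in the same right coset of the powers. The bound on
  \<^term>\<open>j\<close> gives uniform exponents for conjugation and short subwords of geodesics.\<close>

lemma pigeonhole_powers:
  assumes cov: "covers_by_powers a R" and a: "a \<in> carrier G"
    and f: "\<And>i::nat. i \<le> card R \<Longrightarrow> f i \<in> carrier G"
  obtains i j and k :: int where "i < j" "j \<le> card R" "f j \<otimes> inv (f i) = a [^] k"
proof -
  have "\<forall>x\<in>carrier G. \<exists>k::int. \<exists>r. r \<in> R \<and> x = a [^] k \<otimes> r"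
    using cov unfolding covers_by_powers_def by blast
  then obtain \<kappa> \<rho> where \<rho>: "\<And>x. x \<in> carrier G \<Longrightarrow> \<rho> x \<in> R \<and> x = a [^] (\<kappa> x :: int) \<otimes> \<rho> x"
    by metis
  have "(\<lambda>i. \<rho> (f i)) ` {..card R} \<subseteq> R" using \<rho> f by auto
  moreover have "finite R" using cov by (simp add: covers_by_powers_def)
  ultimately have "\<not> inj_on (\<lambda>i. \<rho> (f i)) {..card R}"
    using card_inj_on_le[of "\<lambda>i. \<rho> (f i)" "{..card R}" R] by auto
  then obtain i j where ij: "i \<le> card R" "j \<le> card R" "i \<noteq> j" "\<rho> (f i) = \<rho> (f j)"
    by (auto simp: inj_on_def)
  have quotient: "f m \<otimes> inv (f n) = a [^] (\<kappa> (f m) - \<kappa> (f n))"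
    if "m \<le> card R" "n \<le> card R" "\<rho> (f m) = \<rho> (f n)" for m n
  proof -
    define r where "r = \<rho> (f n)"
    have r: "r \<in> carrier G" using \<rho> f that cov by (auto simp: r_def covers_by_powers_def)
    have "f m = a [^] \<kappa> (f m) \<otimes> r" "f n = a [^] \<kappa> (f n) \<otimes> r"
      using \<rho> f that by (metis r_def)+
    then have "f m \<otimes> inv (f n) = (a [^] \<kappa> (f m) \<otimes> r) \<otimes> inv (a [^] \<kappa> (f n) \<otimes> r)" by simp
    also have "\<dots> = a [^] (\<kappa> (f m) - \<kappa> (f n))"
      using a r by (simp add: inv_mult_group m_assoc int_pow_diff) (simp add: m_assoc[symmetric])
    finally show ?thesis .
  qed
  show thesis
  proof (cases "i < j")
    case True
    then show thesis using that quotient[of j i] ij by metis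
  next
    case False
    then show thesis using that[of j i] quotient[of i j] ij by simp
  qed
qed

text \<open>By pigeonhole a fixed power \<^term>\<open>a [^] M\<close> is conjugated by \<^term>\<open>g\<close> to some \<^term>\<open>a [^] e\<close>, and
  some power of \<^term>\<open>g\<close> is itself a power of \<^term>\<open>a\<close>, so commutes with it. Iterating the
  conjugation that many times gives \<^term>\<open>e ^ m = M ^ m\<close>, whence \<^term>\<open>e = M \<or> e = - M\<close>.\<close>

lemma virtual_axis_exists:
  assumes "virtually_Z G"
  obtains c where "virtual_axis c"
proof -
  obtain a R where a: "a \<in> carrier G" and order: "\<forall>n::int. a [^] n = \<one> \<longrightarrow> n = 0"
    and cov: "covers_by_powers a R"
    using virtually_Z_generator[OF assms] .
  note pow_eq = int_pow_eq_iff[OF a order[rule_format]]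
  \<comment> \<open>A multiple of every exponent that the pigeonhole principle can produce, independent of the
    conjugating element.\<close>
  define M where "M = int (fact (card R))"
  have M: "0 < M" by (simp add: M_def)
  have "g \<otimes> a [^] M \<otimes> inv g \<in> {a [^] M, inv (a [^] M)}" if g: "g \<in> carrier G" for g
  proof -
    have "\<exists>e::int. g \<otimes> a [^] M \<otimes> inv g = a [^] e"
    proof -
      obtain i j k where ij: "i < j" "j \<le> card R"
        and k: "(g \<otimes> a [^] j) \<otimes> inv (g \<otimes> a [^] i) = a [^] (k::int)"
        using pigeonhole_powers[OF cov a, of "\<lambda>i. g \<otimes> a [^] i"] g a by auto
      have "(g \<otimes> a [^] j) \<otimes> inv (g \<otimes> a [^] i) = g \<otimes> (a [^] int j \<otimes> inv (a [^] int i)) \<otimes> inv g"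
        using g a by (simp add: inv_mult_group m_assoc int_pow_int)
      then have conj: "g \<otimes> a [^] (int j - int i) \<otimes> inv g = a [^] k"
        using k a by (simp add: int_pow_diff)
      have "j - i dvd fact (card R)" using ij by (intro dvd_fact) auto
      then have "int (j - i) dvd M" unfolding M_def by (simp only: int_dvd_int_iff)
      then obtain n where n: "M = (int j - int i) * n" using ij by (auto simp: of_nat_diff)
      have "g \<otimes> a [^] M \<otimes> inv g = (g \<otimes> a [^] (int j - int i) \<otimes> inv g) [^] n"
        using g a by (simp add: n int_pow_pow[symmetric] conj_int_pow)
      then have "g \<otimes> a [^] M \<otimes> inv g = a [^] (k * n)" using conj a by (simp add: int_pow_pow)
      then show ?thesis by blast
    qed
    then obtain e :: int where e: "g \<otimes> a [^] M \<otimes> inv g = a [^] e" by blast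
    have step: "g \<otimes> a [^] (M * n) \<otimes> inv g = a [^] (e * n)" for n :: int
      using conj_int_pow[OF g, of "a [^] M" n] e a by (simp add: int_pow_pow)
    have iterate: "g [^] m \<otimes> a [^] (M ^ m) \<otimes> inv (g [^] m) = a [^] (e ^ m)" for m :: nat
    proof -
      have "g [^] m \<otimes> a [^] (M ^ m * n) \<otimes> inv (g [^] m) = a [^] (e ^ m * n)" for n
      proof (induction m arbitrary: n)
        case 0
        then show ?case using a by simp
      next
        case (Suc m)
        have "g [^] Suc m \<otimes> a [^] (M ^ Suc m * n) \<otimes> inv (g [^] Suc m)
            = g \<otimes> (g [^] m \<otimes> a [^] (M ^ m * (M * n)) \<otimes> inv (g [^] m)) \<otimes> inv g"
          unfolding nat_pow_Suc2[OF g] using g a by (simp add: inv_mult_group m_assoc ac_simps)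
        also have "\<dots> = g \<otimes> a [^] (M * (e ^ m * n)) \<otimes> inv g"
          by (simp only: Suc.IH[of "M * n"] mult.left_commute[of M "e ^ m" n])
        also have "\<dots> = a [^] (e ^ Suc m * n)" using step[of "e ^ m * n"] by (simp add: mult.assoc)
        finally show ?case .
      qed
      from this[of 1] show ?thesis by simp
    qed
    obtain i j k where ij: "i < j" "j \<le> card R" and k: "g [^] j \<otimes> inv (g [^] i) = a [^] (k::int)"
      using pigeonhole_powers[OF cov a, of "\<lambda>i. g [^] i"] g by auto
    define m where "m = j - i"
    have m: "0 < m" using ij by (simp add: m_def)
    have "g [^] j = g [^] m \<otimes> g [^] i" using g ij by (simp add: nat_pow_mult m_def)
    then have gm: "g [^] m = a [^] k" using k g by (simp add: m_assoc)
    have "a [^] (e ^ m) = a [^] k \<otimes> a [^] (M ^ m) \<otimes> inv (a [^] k)"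
      using iterate[of m] gm by simp
    also have "\<dots> = a [^] (k + M ^ m - k)" using a by (simp only: int_pow_mult int_pow_diff)
    finally have "e ^ m = M ^ m" using pow_eq by simp
    then have "\<bar>e\<bar> ^ m = \<bar>M\<bar> ^ m" by (simp only: power_abs[symmetric])
    then have "\<bar>e\<bar> = \<bar>M\<bar>" by (rule power_eq_imp_eq_base) (simp_all add: m)
    then have "e = M \<or> e = - M" by linarith
    then show ?thesis using e a by (auto simp: int_pow_neg)
  qed
  moreover have "n = 0" if "(a [^] M) [^] n = \<one>" for n :: int
  proof -
    have "a [^] (M * n) = \<one>" using that a by (simp add: int_pow_pow)
    then show ?thesis using order M by fastforce
  qed
  ultimately have "virtual_axis (a [^] M)"
    using covers_by_powers_int_pow[OF cov a] M a by (simp add: virtual_axis_def)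
  then show thesis by (rule that)
qed

end

section \<open>Straight elements and covering geodesics\<close>

context cayley_graph
begin

lemma geodesic_segment:
  assumes x: "x \<in> carrier G" and y: "y \<in> carrier G"
  obtains p where "p 0 = x" "p (d x y) = y" "\<And>i. i \<le> d x y \<Longrightarrow> p i \<in> carrier G"
    "\<And>i j. i \<le> j \<Longrightarrow> j \<le> d x y \<Longrightarrow> d (p i) (p j) = j - i"
proof -
  obtain p where p: "p 0 = x" "p (d x y) = y"
      and adj: "\<And>i. i < d x y \<Longrightarrow> (p i, p (Suc i)) \<in> cayley_adj G S"
    using path_dist[OF x y] unfolding relpow_fun_conv by blast
  have closed: "p i \<in> carrier G" if "i \<le> d x y" for i
  proof (cases "i = d x y")
    case False
    then show ?thesis using adj[of i] that by (simp add: adj_iff)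
  qed (use p y in simp)
  have le: "d (p i) (p j) \<le> j - i" if "i \<le> j" "j \<le> d x y" for i j
    using that
  proof (induction j rule: dec_induct)
    case (step n)
    have "d (p n) (p (Suc n)) \<le> 1" using adj[of n] step by (intro dist_le) simp
    then show ?case using step dist_triangle[of "p i" "p n" "p (Suc n)"] closed by simp
  qed simp
  have "d (p i) (p j) = j - i" if "i \<le> j" "j \<le> d x y" for i j
  proof -
    have "d x y \<le> d x (p i) + d (p i) (p j) + d (p j) y"
      using dist_triangle[of x "p i" y] dist_triangle[of "p i" "p j" y] closed that x y by simp
    then show ?thesis using le[of 0 i] le[of j "d x y"] le[OF that] that p by simp
  qed
  then show thesis using that p closed by blast
qed

lemma dist_one_inv: "x \<in> carrier G \<Longrightarrow> d \<one> (inv x) = d \<one> x"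
  using dist_one_diff[of x \<one>] dist_sym by simp

lemma dist_one_nat_pow_le: "v \<in> carrier G \<Longrightarrow> d \<one> (v [^] (n::nat)) \<le> n * d \<one> v"
proof (induction n)
  case (Suc n)
  then show ?case
    using dist_triangle[of \<one> "v [^] n" "v [^] n \<otimes> v"] dist_translate[of "v [^] n" \<one> v] by simp
qed simp

text \<open>Among the powers of an axis whose length is at most a constant \<^term>\<open>Q\<close>, take one that moves
  fastest along the axis. Any longer power has, by pigeonhole, a proper subword of length at most
  \<^term>\<open>Q\<close> that is itself a power of the axis; cutting such subwords out one after the other shows
  that no power moves faster. The powers of the chosen one are therefore geodesic.\<close>

lemma straight_axis_exists:
  assumes axis: "virtual_axis c"
  obtains u where "virtual_axis u" "0 < d \<one> u" "\<And>n::nat. d \<one> (u [^] n) = n * d \<one> u"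
proof -
  have c: "c \<in> carrier G" and order: "\<And>n::int. c [^] n = \<one> \<Longrightarrow> n = 0"
    and conj: "\<And>g. g \<in> carrier G \<Longrightarrow> g \<otimes> c \<otimes> inv g \<in> {c, inv c}"
    using axis by (auto simp: virtual_axis_def)
  obtain R where cov: "covers_by_powers c R" using axis by (auto simp: virtual_axis_def)
  define len where "len k = d \<one> (c [^] k)" for k :: int
  have len_0: "k = 0" if "len k = 0" for k
    using dist_eq_0D[of \<one> "c [^] k"] c order that by (simp add: len_def)
  have len_neg: "len (- k) = len k" for k
    using dist_one_inv[of "c [^] k"] c by (simp add: len_def int_pow_neg)
  \<comment> \<open>\<open>card R\<close> is what the pigeonhole principle needs; \<open>len 1\<close> makes \<open>E\<close> nonempty.\<close>
  define Q where "Q = max (card R) (len 1)"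
  define E where "E = {e. e \<noteq> 0 \<and> len e \<le> Q}"
  have "(\<lambda>e::int. c [^] e) ` E \<subseteq> {y \<in> carrier G. d \<one> y \<le> Q}" using c by (auto simp: E_def len_def)
  then have "finite ((\<lambda>e::int. c [^] e) ` E)" using finite_ball[OF one_closed] finite_subset by metis
  moreover have "inj_on (\<lambda>e::int. c [^] e) E"
    using int_pow_eq_iff[OF c order] by (simp add: inj_on_def)
  ultimately have "finite E" using finite_imageD by blast
  moreover have "1 \<in> E" by (simp add: E_def Q_def)
  ultimately have "Max ((\<lambda>e. \<bar>real_of_int e\<bar> / real (len e)) ` E)
      \<in> (\<lambda>e. \<bar>real_of_int e\<bar> / real (len e)) ` E"
    by (intro Max_in) auto
  then obtain e where e: "e \<in> E"
    and "\<bar>real_of_int e\<bar> / real (len e) = Max ((\<lambda>e. \<bar>real_of_int e\<bar> / real (len e)) ` E)"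
    by auto
  then have fastest: "\<bar>real_of_int f\<bar> / real (len f) \<le> \<bar>real_of_int e\<bar> / real (len e)" if "f \<in> E" for f
    using \<open>finite E\<close> that by simp
  define \<rho> where "\<rho> = \<bar>real_of_int e\<bar> / real (len e)"
  have e0: "e \<noteq> 0" "0 < len e" using e len_0[of e] by (auto simp: E_def)
  have \<rho>: "0 < \<rho>" using e0 by (simp add: \<rho>_def)
  have short: "\<bar>real_of_int f\<bar> \<le> \<rho> * real (len f)" if "len f \<le> Q" for f
  proof (cases "f = 0")
    case True
    then show ?thesis using \<rho> by simp
  next
    case False
    then have "0 < len f" using len_0[of f] by auto
    moreover have "\<bar>real_of_int f\<bar> / real (len f) \<le> \<rho>"
      using fastest[of f] False that by (simp add: E_def \<rho>_def)
    ultimately show ?thesis by (simp add: field_simps)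
  qed
  have speed: "\<bar>real_of_int k\<bar> \<le> \<rho> * real (len k)" for k
  proof (induction "len k" arbitrary: k rule: less_induct)
    case less
    show ?case
    proof (cases "len k \<le> Q")
      case False
      then have Q: "card R < len k" by (simp add: Q_def)
      have ck: "c [^] k \<in> carrier G" using c by simp
      obtain p where p: "p 0 = \<one>" "p (len k) = c [^] k"
        and p_closed: "\<And>i. i \<le> len k \<Longrightarrow> p i \<in> carrier G"
        and p_dist: "\<And>i j. i \<le> j \<Longrightarrow> j \<le> len k \<Longrightarrow> d (p i) (p j) = j - i"
        using geodesic_segment[OF one_closed ck] unfolding len_def by blast
      have "\<And>i. i \<le> card R \<Longrightarrow> p i \<in> carrier G" using p_closed Q by simp
      then obtain i j f where ij: "i < j" "j \<le> card R" and f: "p j \<otimes> inv (p i) = c [^] (f::int)"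
        using pigeonhole_powers[OF cov c, of p] by blast
      have pG: "p i \<in> carrier G" "p j \<in> carrier G" using p_closed ij Q by auto
      have "inv (p i) \<otimes> p j = inv (p i) \<otimes> (p j \<otimes> inv (p i)) \<otimes> p i"
        using pG by (simp add: m_assoc)
      also have "\<dots> = (inv (p i) \<otimes> c \<otimes> p i) [^] f"
        using conj_int_pow[of "inv (p i)" c f] pG c by (simp add: f)
      also have "\<dots> = c [^] f \<or> \<dots> = c [^] (- f)"
        using conj[of "inv (p i)"] pG c by (auto simp: int_pow_inv int_pow_neg)
      finally have "inv (p i) \<otimes> p j = c [^] f \<or> inv (p i) \<otimes> p j = c [^] (- f)" .
      then have "d \<one> (inv (p i) \<otimes> p j) = len f" using len_neg[of f] by (auto simp: len_def)
      then have len_f: "len f = j - i"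
        using dist_one_diff[OF pG] p_dist[of i j] ij Q by simp
      have "c [^] (k - f) = c [^] (- f + k)" by simp
      also have "\<dots> = inv (p j \<otimes> inv (p i)) \<otimes> c [^] k"
        using c by (simp only: int_pow_mult int_pow_neg f)
      finally have rest: "c [^] (k - f) = p i \<otimes> (inv (p j) \<otimes> c [^] k)"
        using pG c by (simp add: inv_mult_group m_assoc)
      have "len (k - f) \<le> d \<one> (p i) + d (p i) (p i \<otimes> (inv (p j) \<otimes> c [^] k))"
        using dist_triangle[of \<one> "p i" "c [^] (k - f)"] pG c by (simp add: rest len_def)
      also have "d (p i) (p i \<otimes> (inv (p j) \<otimes> c [^] k)) = d (p j) (c [^] k)"
        using dist_translate[of "p i" \<one> "inv (p j) \<otimes> c [^] k"] dist_one_diff[OF pG(2) ck] pG ck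
        by simp
      finally have "len (k - f) \<le> i + (len k - j)"
        using p_dist[of 0 i] p_dist[of j "len k"] ij Q p by simp
      then have cut: "len (k - f) + len f \<le> len k" using len_f ij Q by simp
      have "len (k - f) < len k" using cut len_f ij by simp
      then have "\<bar>real_of_int (k - f)\<bar> \<le> \<rho> * real (len (k - f))" by (rule less)
      moreover have "\<bar>real_of_int f\<bar> \<le> \<rho> * real (len f)"
        using short[of f] len_f ij by (simp add: Q_def)
      moreover have "\<rho> * (real (len (k - f)) + real (len f)) \<le> \<rho> * real (len k)"
        using cut \<rho> by (intro mult_left_mono) auto
      ultimately show ?thesis by (simp add: algebra_simps)
    qed (rule short)
  qed
  define u where "u = c [^] e"
  have uG: "u \<in> carrier G" using c by (simp add: u_def)
  have u: "d \<one> u = len e" by (simp add: u_def len_def)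
  have "d \<one> (u [^] n) = n * d \<one> u" for n :: nat
  proof (rule antisym)
    show "d \<one> (u [^] n) \<le> n * d \<one> u" using dist_one_nat_pow_le[OF uG] .
    have "u [^] n = c [^] (e * int n)" using c by (simp add: u_def int_pow_int[symmetric] int_pow_pow)
    then have "\<bar>real_of_int (e * int n)\<bar> \<le> \<rho> * real (d \<one> (u [^] n))"
      using speed[of "e * int n"] by (simp add: len_def)
    then have "\<bar>real_of_int e\<bar> * real n \<le> \<bar>real_of_int e\<bar> * real (d \<one> (u [^] n)) / real (len e)"
      by (simp add: abs_mult \<rho>_def)
    then have "real n \<le> real (d \<one> (u [^] n)) / real (len e)" using e0 by (simp add: field_simps)
    then have "real n * real (len e) \<le> real (d \<one> (u [^] n))" using e0 by (simp add: field_simps)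
    then show "n * d \<one> u \<le> d \<one> (u [^] n)" unfolding u
      by (simp only: of_nat_mult[symmetric] of_nat_le_iff)
  qed
  moreover have "virtual_axis u" unfolding u_def by (rule virtual_axis_int_pow[OF axis e0(1)])
  ultimately show thesis using that e0 u by metis
qed

text \<open>Repeating a geodesic word for a straight element gives a geodesic ray; \<^term>\<open>\<gamma> n\<close> is read
  off by division with remainder by the length of the word.\<close>

lemma periodic_geodesic:
  assumes x: "x \<in> carrier G" and v: "v \<in> carrier G" and pos: "0 < d \<one> v"
    and straight: "\<And>n::nat. d \<one> (v [^] n) = n * d \<one> v"
  obtains \<gamma> where "cayley_geodesic G S \<gamma>" "\<And>n::nat. x \<otimes> v [^] n \<in> range \<gamma>"
proof -
  define l where "l = d \<one> v"
  have l: "0 < l" using pos by (simp add: l_def)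
  obtain p where p: "p 0 = \<one>" "p l = v"
    and p_closed: "\<And>i. i \<le> l \<Longrightarrow> p i \<in> carrier G"
    and p_dist: "\<And>i j. i \<le> j \<Longrightarrow> j \<le> l \<Longrightarrow> d (p i) (p j) = j - i"
    using geodesic_segment[OF one_closed v] unfolding l_def by blast
  define \<gamma> where "\<gamma> n = x \<otimes> v [^] (n div l) \<otimes> p (n mod l)" for n
  have mod: "n mod l < l" for n using l by simp
  have vertex: "\<gamma> (n * l) = x \<otimes> v [^] n" for n using l x v p by (simp add: \<gamma>_def)
  have "cayley_geodesic G S \<gamma>"
  proof (rule geodesicI)
    show "\<gamma> n \<in> carrier G" for n using p_closed mod[of n] x v by (simp add: \<gamma>_def less_imp_le)
    show "d (\<gamma> n) (\<gamma> (Suc n)) \<le> 1" for n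
    proof -
      have pn: "p (n mod l) \<in> carrier G" "p (Suc (n mod l)) \<in> carrier G"
        using p_closed mod[of n] by (simp_all add: Suc_leI)
      have "\<gamma> (Suc n) = x \<otimes> v [^] (n div l) \<otimes> p (Suc (n mod l))"
      proof (cases "Suc (n mod l) = l")
        case True
        then have "Suc n div l = Suc (n div l)" "Suc n mod l = 0" by (simp_all add: div_Suc mod_Suc)
        then show ?thesis using p x v True by (simp add: \<gamma>_def m_assoc)
      next
        case False
        then have "Suc n div l = n div l" "Suc n mod l = Suc (n mod l)"
          by (simp_all add: div_Suc mod_Suc)
        then show ?thesis by (simp add: \<gamma>_def)
      qed
      then have "d (\<gamma> n) (\<gamma> (Suc n)) = d (p (n mod l)) (p (Suc (n mod l)))"
        using pn x v by (simp add: \<gamma>_def)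
      then show ?thesis using p_dist[of "n mod l" "Suc (n mod l)"] mod[of n] by simp
    qed
    show "\<exists>N\<ge>n. N \<le> d (\<gamma> 0) (\<gamma> N)" for n
    proof (intro exI conjI)
      show "n \<le> n * l" using l by simp
      show "n * l \<le> d (\<gamma> 0) (\<gamma> (n * l))"
        using vertex[of 0] vertex[of n] dist_translate[of x \<one> "v [^] n"] straight[of n] x v
        by (simp add: l_def)
    qed
  qed
  then show thesis using that vertex by (metis rangeI)
qed

text \<open>The powers of a straight axis are carried to straight elements by conjugation, so each orbit
  of the axis under left multiplication lies on two geodesics, one for each direction.\<close>

lemma covered_by_geodesics_if_virtually_Z:
  assumes "virtually_Z G"
  obtains \<G> where "finite \<G>" "\<forall>\<gamma>\<in>\<G>. cayley_geodesic G S \<gamma>"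
    "carrier G \<subseteq> (\<Union>\<gamma>\<in>\<G>. range \<gamma>)"
proof -
  obtain c where "virtual_axis c" using virtual_axis_exists[OF assms] .
  then obtain u where axis: "virtual_axis u" and pos: "0 < d \<one> u"
    and straight: "\<And>n::nat. d \<one> (u [^] n) = n * d \<one> u"
    by (rule straight_axis_exists) blast
  have u: "u \<in> carrier G" using axis by (simp add: virtual_axis_def)
  obtain R where cov: "covers_by_powers u R" using axis by (auto simp: virtual_axis_def)
  have RG: "r \<in> carrier G" if "r \<in> R" for r using cov that by (auto simp: covers_by_powers_def)
  have ray: "\<exists>\<gamma>. cayley_geodesic G S \<gamma> \<and> (\<forall>n::nat. w [^] n \<otimes> r \<in> range \<gamma>)"
    if w: "w \<in> {u, inv u}" and r: "r \<in> R" for w r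
  proof -
    have wG: "w \<in> carrier G" using w u by auto
    define v where "v = inv r \<otimes> w \<otimes> r"
    have v: "v \<in> carrier G" using wG RG[OF r] by (simp add: v_def)
    have "\<forall>g\<in>carrier G. g \<otimes> u \<otimes> inv g \<in> {u, inv u}"
      using axis unfolding virtual_axis_def by (elim conjE)
    then have "inv r \<otimes> u \<otimes> inv (inv r) \<in> {u, inv u}"
      using inv_closed[OF RG[OF r]] by (rule bspec)
    moreover have "inv (inv r \<otimes> u \<otimes> r) = inv r \<otimes> inv u \<otimes> r"
      using RG[OF r] u by (simp add: inv_mult_group m_assoc)
    ultimately have "v \<in> {u, inv u}" using w u RG[OF r] by (auto simp: v_def)
    moreover have "d \<one> ((inv u) [^] n) = d \<one> (u [^] n)" for n :: nat
      using dist_one_inv[of "u [^] n"] u by (simp add: nat_pow_inv)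
    ultimately have "0 < d \<one> v" "\<And>n::nat. d \<one> (v [^] n) = n * d \<one> v"
      using pos straight dist_one_inv[OF u] by auto
    then obtain \<gamma> where \<gamma>: "cayley_geodesic G S \<gamma>" "\<And>n::nat. r \<otimes> v [^] n \<in> range \<gamma>"
      using periodic_geodesic[OF RG[OF r] v] by metis
    have "r \<otimes> v [^] n = w [^] n \<otimes> r" for n :: nat
    proof -
      have "inv r \<otimes> w [^] n \<otimes> r = v [^] n"
        using conj_int_pow[of "inv r" w "int n"] RG[OF r] wG by (simp add: int_pow_int v_def)
      then have "r \<otimes> v [^] n = r \<otimes> (inv r \<otimes> w [^] n \<otimes> r)" by simp
      then show ?thesis using RG[OF r] wG by (simp add: m_assoc[symmetric])
    qed
    then show ?thesis using \<gamma> by auto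
  qed
  then obtain \<Gamma> where \<Gamma>: "\<And>w r. w \<in> {u, inv u} \<Longrightarrow> r \<in> R \<Longrightarrow> cayley_geodesic G S (\<Gamma> w r)"
      "\<And>w r (n::nat). w \<in> {u, inv u} \<Longrightarrow> r \<in> R \<Longrightarrow> w [^] n \<otimes> r \<in> range (\<Gamma> w r)"
    by metis
  define \<G> where "\<G> = (\<lambda>(w, r). \<Gamma> w r) ` ({u, inv u} \<times> R)"
  have "finite \<G>" using cov by (simp add: \<G>_def covers_by_powers_def)
  moreover have "\<forall>\<gamma>\<in>\<G>. cayley_geodesic G S \<gamma>" using \<Gamma>(1) by (auto simp: \<G>_def)
  moreover have "carrier G \<subseteq> (\<Union>\<gamma>\<in>\<G>. range \<gamma>)"
  proof
    fix x assume "x \<in> carrier G"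
    then obtain k :: int and r where r: "r \<in> R" "x = u [^] k \<otimes> r"
      using cov by (auto simp: covers_by_powers_def)
    have "\<exists>w\<in>{u, inv u}. \<exists>n::nat. u [^] k = w [^] n"
    proof (cases k rule: int_cases2)
      case (nonneg n)
      then have "u [^] k = u [^] n" by (simp add: int_pow_int)
      then show ?thesis by blast
    next
      case (nonpos n)
      then have "u [^] k = inv u [^] n" using u by (simp add: int_pow_neg int_pow_int nat_pow_inv)
      then show ?thesis by blast
    qed
    then obtain w n where w: "w \<in> {u, inv u}" "u [^] k = w [^] (n::nat)" by blast
    then have "x \<in> range (\<Gamma> w r)" using \<Gamma>(2) r by simp
    moreover have "\<Gamma> w r \<in> \<G>" using w r by (auto simp: \<G>_def)
    ultimately show "x \<in> (\<Union>\<gamma>\<in>\<G>. range \<gamma>)" by blast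
  qed
  ultimately show thesis using that by blast
qed

end

section \<open>The characterisation by boundaries\<close>

lemma (in group) symmetric_generating_set_exists:
  assumes "finitely_generated_group G"
  obtains S where "symmetric_generating_set G S"
proof -
  obtain T where T: "finite T" "T \<subseteq> carrier G" "generate G T = carrier G"
    using assms by (auto simp: finitely_generated_group_def)
  let ?S = "T \<union> (\<lambda>x. inv x) ` T"
  have S: "?S \<subseteq> carrier G" using T by auto
  have "generate G T \<subseteq> generate G ?S" by (rule mono_generate) auto
  then have "generate G ?S = carrier G" using T generate_incl[OF S] by auto
  moreover have "set_inv ?S = ?S"
    using T(2) by (force simp: SET_INV_def)
  ultimately have "symmetric_generating_set G ?S" using T S by (simp add: symmetric_generating_set_def)
  then show thesis by (rule that)
qed

theorem theorem1p3:
  fixes G :: "('a, 'b) monoid_scheme"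
  assumes "group G"
    and "infinite (carrier G)"
    and "finitely_generated_group G"
  shows "(virtually_Z G \<longleftrightarrow>
            (\<forall>S. symmetric_generating_set G S \<longrightarrow> finite (busemann_boundary G S)))
       \<and> (virtually_Z G \<longleftrightarrow>
            (\<forall>S. symmetric_generating_set G S \<longrightarrow> finite (horofunction_boundary G S)))
       \<and> (virtually_Z G \<longrightarrow>
            (\<forall>S. symmetric_generating_set G S \<longrightarrow>
               (\<forall>h \<in> horofunction_boundary G S. h \<in> busemann_points G S)))"
proof -
  interpret group G by fact
  have vZ: "finite (horofunction_boundary G S)"
      "horofunction_boundary G S \<subseteq> busemann_points G S"
    if vZ: "virtually_Z G" and S: "symmetric_generating_set G S" for S
  proof -
    interpret cayley_graph G S by unfold_locales (rule S)
    obtain \<G> where \<G>: "finite \<G>" "\<forall>\<gamma>\<in>\<G>. cayley_geodesic G S \<gamma>"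
        "carrier G \<subseteq> (\<Union>\<gamma>\<in>\<G>. range \<gamma>)"
      by (rule covered_by_geodesics_if_virtually_Z[OF vZ])
    show "finite (horofunction_boundary G S)"
      "horofunction_boundary G S \<subseteq> busemann_points G S"
      using boundary_if_covered_by_geodesics[OF \<G>] .
  qed
  have fin_boundary: "finite (busemann_boundary G S) \<longleftrightarrow> finite (busemann_points G S)"
    and subset: "busemann_points G S \<subseteq> horofunction_boundary G S"
    if S: "symmetric_generating_set G S" for S
  proof -
    interpret cayley_graph G S by unfold_locales (rule S)
    show "finite (busemann_boundary G S) \<longleftrightarrow> finite (busemann_points G S)"
      by (rule finite_busemann_boundary_iff)
    show "busemann_points G S \<subseteq> horofunction_boundary G S" by (rule busemann_points_subset)
  qed
  obtain S0 where S0: "symmetric_generating_set G S0"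
    using symmetric_generating_set_exists[OF assms(3)] .
  have vZ_if: "virtually_Z G"
    if "\<And>S. symmetric_generating_set G S \<Longrightarrow> finite (busemann_points G S)"
    by (rule virtually_Z_if_finite_busemann_points[OF assms(2) S0 that])
  show ?thesis
  proof (intro conjI iffI impI allI ballI)
    fix S assume *: "virtually_Z G" "symmetric_generating_set G S"
    show "finite (horofunction_boundary G S)" by (rule vZ(1)[OF *])
    then have "finite (busemann_points G S)" by (rule rev_finite_subset[OF _ subset[OF *(2)]])
    then show "finite (busemann_boundary G S)" by (simp only: fin_boundary[OF *(2)])
  next
    assume "\<forall>S. symmetric_generating_set G S \<longrightarrow> finite (busemann_boundary G S)"
    then show "virtually_Z G" using fin_boundary by (intro vZ_if) simp
  next
    assume fin: "\<forall>S. symmetric_generating_set G S \<longrightarrow> finite (horofunction_boundary G S)"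
    show "virtually_Z G"
    proof (rule vZ_if)
      fix S assume S: "symmetric_generating_set G S"
      then have "finite (horofunction_boundary G S)" using fin by simp
      then show "finite (busemann_points G S)" by (rule rev_finite_subset[OF _ subset[OF S]])
    qed
  next
    fix S h assume "virtually_Z G" "symmetric_generating_set G S" "h \<in> horofunction_boundary G S"
    then show "h \<in> busemann_points G S" using vZ(2) by blast
  qed
qed

end
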